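(* If $k$ is a positive integer, then $\omega^{\omega\cdot k}+1\to_{cl}(\omega^2+1,k+2)^2$.
   Context: All arithmetic operations on ordinals are in the ordinal sense. Every ordinal is identified with the set of smaller ordinals and carries the order topology; subsets carry the subspace topology. A set $X$ of ordinals is order-homeomorphic to an ordinal $\alpha$ (a closed copy of $\alpha$) if there is a bijection $X\to\alpha$ that is both an order-isomorphism and a homeomorphism; equivalently, $X$ is order-isomorphic to $\alpha$ and closed in its supremum. $[X]^2$ is the set of $2$-element subsets of $X$. $\beta\to_{cl}(\alpha,k)^2$ means: for every coloring $c:[\beta]^2\to\{\text{red},\text{blue}\}$ either there is $X\subseteq\beta$ order-homeomorphic to $\alpha$ with all elements of $[X]^2$ red, or there is a $k$-element $Y\subseteq\beta$ with all elements of $[Y]^2$ blue. *)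

theory Defs
  imports "HOL-Analysis.Analysis" "HOL-Library.Ramsey"
begin

text \<open>
  An ordinal is represented by a reflexive well-order relation of its order type, in the sense of
  \<^const>\<open>Well_order\<close>; the set of smaller ordinals is the \<^const>\<open>Field\<close> of the relation.
  The ordinal \<open>\<omega>\<close> is \<^const>\<open>natLeq\<close> and the finite ordinal \<open>n\<close> is \<open>natLeq_on n\<close>.
\<close>

subsection \<open>Ordinal arithmetic\<close>

definition ord_add :: "'a rel \<Rightarrow> 'b rel \<Rightarrow> ('a + 'b) rel"  (infixr \<open>+\<^sub>o\<close> 70) where
  "r +\<^sub>o s = map_prod Inl Inl ` r \<union> map_prod Inr Inr ` s \<union> (Inl ` Field r) \<times> (Inr ` Field s)"

text \<open>The product is \<open>s\<close> copies of \<open>r\<close>, so the second coordinate is the significant one.\<close>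

definition ord_mult :: "'a rel \<Rightarrow> 'b rel \<Rightarrow> ('a \<times> 'b) rel"  (infixr \<open>*\<^sub>o\<close> 80) where
  "r *\<^sub>o s = {((a, b), (a', b')). a \<in> Field r \<and> a' \<in> Field r \<and> b \<in> Field s \<and> b' \<in> Field s \<and>
     (b \<in> underS s b' \<or> b = b' \<and> (a, a') \<in> r)}"

text \<open>
  The power \<open>r\<^sup>s\<close> is the order type of the finitely supported functions from \<open>s\<close> to \<open>r\<close>, compared at
  the largest argument where they differ (Cantor normal form when \<open>r\<close> is \<open>\<omega>\<close>). A value is nonzero
  iff it has a predecessor, so \<open>{x \<in> Field s. underS r (f x) \<noteq> {}}\<close> is the support of \<open>f\<close>.
\<close>

definition fin_supp :: "'a rel \<Rightarrow> 'b rel \<Rightarrow> ('b \<Rightarrow> 'a) set" where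
  "fin_supp r s = {f \<in> Field s \<rightarrow>\<^sub>E Field r. finite {x \<in> Field s. underS r (f x) \<noteq> {}}}"

definition ord_exp :: "'a rel \<Rightarrow> 'b rel \<Rightarrow> ('b \<Rightarrow> 'a) rel"  (infixr \<open>^\<^sub>o\<close> 90) where
  "r ^\<^sub>o s = {(f, g). f \<in> fin_supp r s \<and> g \<in> fin_supp r s \<and>
     (f = g \<or> (\<exists>m \<in> Field s. f m \<in> underS r (g m) \<and> (\<forall>x \<in> aboveS s m. f x = g x)))}"

subsection \<open>The closed partition relation\<close>

text \<open>
  The subbase of open rays is extended by the whole space, which the rays fail to cover when the
  field is a singleton.
\<close>

definition ord_topology :: "'a rel \<Rightarrow> 'a topology" where
  "ord_topology r =
     topology_generated_by (insert (Field r) (underS r ` Field r \<union> aboveS r ` Field r))"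

definition closed_copy :: "'a rel \<Rightarrow> 'a set \<Rightarrow> 'b rel \<Rightarrow> bool" where
  "closed_copy r X s \<longleftrightarrow> X \<subseteq> Field r \<and>
     (\<exists>f. iso (Restr r X) s f \<and>
          homeomorphic_map (subtopology (ord_topology r) X) (ord_topology s) f)"

datatype colour = Red | Blue

text \<open>
  A colouring is a total function on sets, of which only the values on two-element subsets of
  \<open>Field \<beta>\<close> matter.
\<close>

definition closed_arrow :: "'a rel \<Rightarrow> 'b rel \<Rightarrow> nat \<Rightarrow> bool" where
  "closed_arrow \<beta> \<alpha> k \<longleftrightarrow> (\<forall>c :: 'a set \<Rightarrow> colour.
     (\<exists>X. closed_copy \<beta> X \<alpha> \<and> (\<forall>e \<in> [X]\<^bsup>2\<^esup>. c e = Red)) \<or>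
     (\<exists>Y \<in> [Field \<beta>]\<^bsup>k\<^esup>. \<forall>e \<in> [Y]\<^bsup>2\<^esup>. c e = Blue))"

end

theory Submission
  imports Defs
begin

text \<open>
  Strictly increasing sequences of naturals of length at most \<open>N\<close>, each placed above its proper extensions,
  form a closed copy of \<open>\<omega>\<^bsup>N\<^esup> + 1\<close> inside \<open>\<omega>\<^bsup>\<omega>\<^esup>\<close>: the extensions \<open>u @ x # s\<close> converge to \<open>u\<close>
  as \<open>x\<close> grows. By Ramsey's theorem we may assume that the colour of a pair depends only on the
  relative order of the entries. A copy of \<open>\<omega>\<^sup>2 + 1\<close> is given by a top \<open>v\<close> of length \<open>h\<close>, limit points \<open>v @ A n\<close>
  of length \<open>i\<close> and further points \<open>v @ A n @ B n m\<close> of length \<open>j\<close>; its pairs realise a bounded number of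
  order types, which depend only on \<open>h < i < j\<close>. If for every triple of lengths one of these types
  were blue, then, by the finite Ramsey theorem, the same type would be blue for all triples from a large
  set of lengths, and nodes branching off one after another along a chain would form a blue clique.
  Hence a finite \<open>N\<close>, depending only on the size of the clique, suffices.
\<close>

text \<open>Interleaved pairs are unavoidable. For \<open>n < n'\<close> the entries of
  \<open>A n'\<close> are fixed while the heads of \<open>B n k\<close> grow with \<open>k\<close>,
  so almost all of these tails start beyond \<open>A n'\<close>; conversely each
  \<open>B n k\<close> ends before \<open>A n'\<close> once \<open>n'\<close> is large. Every copy
  of this form therefore contains both pairs in separate blocks and interleaved ones, and all their
  types have to be red for one and the same triple of lengths. The two uses of Ramsey's theorem act
  on different objects. The infinite one thins out the entries and depends on the colouring; it has
  to control patterns of \<open>2 * N\<close> entries, because two nodes of length at most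
  \<open>N\<close> have no more. The finite one thins out the lengths and must not depend on the
  colouring: the colouring of sequences is pulled back along \<open>emb k N\<close>, so it exists
  only once \<open>N\<close> is fixed.\<close>

subsection \<open>Colourings of finite increasing sequences\<close>

text \<open>
  The value of \<open>D\<close> depends only on the relative order of the entries, provided that at most \<open>K\<close> distinct
  values occur.
\<close>

definition canonical :: "nat \<Rightarrow> (nat list \<Rightarrow> nat list \<Rightarrow> bool) \<Rightarrow> bool" where
  "canonical K D \<longleftrightarrow> (\<forall>w w' I J. strict_sorted w \<longrightarrow> strict_sorted w' \<longrightarrow> length w = length w' \<longrightarrow>
     length w \<le> K \<longrightarrow> set I \<union> set J \<subseteq> {..<length w} \<longrightarrow> length I \<le> K \<longrightarrow> length J \<le> K \<longrightarrow>
     D (map ((!) w) I) (map ((!) w) J) = D (map ((!) w') I) (map ((!) w') J))"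

section \<open>Homogeneous entries: from an arbitrary to a canonical colouring\<close>

lemma infinite_Ramsey_finite_range:
  fixes F :: "nat set \<Rightarrow> 'c"
  assumes "finite (range F)"
  obtains H c where "infinite H" "\<And>X. X \<subseteq> H \<Longrightarrow> finite X \<Longrightarrow> card X = r \<Longrightarrow> F X = c"
proof -
  obtain f and n :: nat where f: "f ` range F = {i. i < n}" "inj_on f (range F)"
    using finite_imp_inj_to_nat_seg[OF assms] by metis
  have "\<forall>X. X \<subseteq> UNIV \<and> finite X \<and> card X = r \<longrightarrow> f (F X) < n"
    using f(1) by blast
  then obtain H t where H: "infinite H" "\<forall>X. X \<subseteq> H \<and> finite X \<and> card X = r \<longrightarrow> f (F X) = t"
    using Ramsey[of "UNIV :: nat set" r "\<lambda>X. f (F X)" n] by auto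
  then have "F X = inv_into (range F) f t" if "X \<subseteq> H" "finite X" "card X = r" for X
    using that f(2) by (metis inv_into_f_f rangeI)
  with H(1) that show thesis
    by blast
qed

lemma strict_sorted_upto_append:
  fixes w :: "nat list"
  assumes "strict_sorted w" "length w \<le> K"
  obtains w' where "strict_sorted (w @ w')" "length (w @ w') = K"
proof -
  obtain M where "\<forall>x\<in>set w. x < M"
    using finite_nat_set_iff_bounded by auto
  then have "strict_sorted (w @ [M..<M + (K - length w)])"
    using assms by (auto simp: sorted_wrt_append)
  then show thesis
    using that assms by auto
qed

text \<open>The colour of a \<open>K\<close>-element set is the whole table of values of
  \<open>C\<close> on the sequences read off from its increasing enumeration. There are finitely
  many tables, so Ramsey's theorem yields an infinite \<open>H\<close> with a single one, and
  \<open>g\<close> enumerates \<open>H\<close>.\<close>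

lemma canonical_subtree:
  fixes C :: "nat list \<Rightarrow> nat list \<Rightarrow> bool"
  obtains g where "strict_mono g" "canonical K (\<lambda>xs ys. C (map g xs) (map g ys))"
proof -
  define Is where "Is = {I. set I \<subseteq> {..<K} \<and> length I \<le> K}"
  define F where "F X = {(I, J) \<in> Is \<times> Is.
    C (map ((!) (sorted_list_of_set X)) I) (map ((!) (sorted_list_of_set X)) J)}" for X
  have "range F \<subseteq> Pow (Is \<times> Is)"
    by (auto simp: F_def)
  moreover have "finite Is"
    unfolding Is_def by (rule finite_lists_length_le) simp
  ultimately have "finite (range F)"
    by (meson finite_Pow_iff finite_SigmaI finite_subset)
  then obtain H c where H: "infinite H" "\<And>X. X \<subseteq> H \<Longrightarrow> finite X \<Longrightarrow> card X = K \<Longrightarrow> F X = c"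
    using infinite_Ramsey_finite_range[where r = K] by metis
  define g where "g = enumerate H"
  have g: "strict_mono g"
    unfolding g_def using H(1) by (rule strict_mono_enumerate)
  have *: "C (map g (map ((!) w) I)) (map g (map ((!) w) J)) \<longleftrightarrow> (I, J) \<in> c"
    if w: "strict_sorted w" "length w \<le> K" and IJ: "set I \<union> set J \<subseteq> {..<length w}"
      "length I \<le> K" "length J \<le> K" for w I J
  proof -
    \<comment> \<open>A shorter \<open>w\<close> is padded at its end; \<open>I\<close> and
      \<open>J\<close> contain only positions below \<open>length w\<close> and read the same
      entries as before.\<close>
    obtain w' where w': "strict_sorted (w @ w')" "length (w @ w') = K"
      using w strict_sorted_upto_append by blast
    let ?W = "map g (w @ w')"
    have sW: "strict_sorted ?W"
      using w'(1) g by (simp only: sorted_wrt_map strict_mono_less)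
    have sl: "sorted_list_of_set (set ?W) = ?W"
      using sW by (metis strict_sorted_equal strict_sorted_list_of_set set_sorted_list_of_set List.finite_set)
    have "set ?W \<subseteq> H"
      unfolding g_def using H(1) by (auto simp: enumerate_in_set)
    moreover have "card (set ?W) = K"
      using sW w'(2) by (metis distinct_card length_map strict_sorted_iff)
    ultimately have "F (set ?W) = c"
      using H(2) by simp
    moreover have "(I, J) \<in> Is \<times> Is"
      using IJ w(2) by (auto simp: Is_def)
    ultimately have "C (map ((!) ?W) I) (map ((!) ?W) J) \<longleftrightarrow> (I, J) \<in> c"
      unfolding F_def sl by auto
    moreover have "map ((!) ?W) I = map g (map ((!) w) I)" "map ((!) ?W) J = map g (map ((!) w) J)"
      using IJ(1) by (auto simp: nth_append)
    ultimately show ?thesis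
      by metis
  qed
  have "canonical K (\<lambda>xs ys. C (map g xs) (map g ys))"
    unfolding canonical_def by (metis (no_types, lifting) *)
  with g that show thesis
    by blast
qed

text \<open>A list operation that commutes with every \<open>map\<close> only selects positions: its
  value at \<open>w\<close> is read off from its value at \<open>[0..<length w]\<close>. These
  values are the index lists to which \<open>canonical\<close> applies, so operations built from
  \<open>take\<close> and \<open>drop\<close> can be used without computing any indices.\<close>

lemma canonical_natural:
  assumes D: "canonical K D"
    and nat: "\<And>(f :: nat \<Rightarrow> nat) w. F (map f w) = map f (F w)" "\<And>(f :: nat \<Rightarrow> nat) w. G (map f w) = map f (G w)"
    and set: "\<And>w. set (F w) \<union> set (G w) \<subseteq> set w"
    and len: "\<And>w. length (F w) \<le> length w" "\<And>w. length (G w) \<le> length w"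
    and w: "strict_sorted w" "strict_sorted w'" "length w = length w'" "length w \<le> K"
  shows "D (F w) (G w) \<longleftrightarrow> D (F w') (G w')"
proof -
  let ?l = "[0..<length w]"
  have "F w = map ((!) w) (F ?l)" "G w = map ((!) w) (G ?l)"
    "F w' = map ((!) w') (F ?l)" "G w' = map ((!) w') (G ?l)"
    using w(3) by (metis map_nth nat(1), metis map_nth nat(2), metis map_nth nat(1), metis map_nth nat(2))
  moreover have "set (F ?l) \<union> set (G ?l) \<subseteq> {..<length w}"
    using set[of ?l] by auto
  moreover have "length (F ?l) \<le> K" "length (G ?l) \<le> K"
    using len[of ?l] w(4) by auto
  ultimately show ?thesis
    using D w unfolding canonical_def by metis
qed

text \<open>
  Two nodes with longest common prefix \<open>u\<close> are cut into blocks \<open>A < B < E < F\<close>, which may be empty.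
  Crossing and nesting refer to the order of the tails of \<open>u @ A @ _\<close> and \<open>u @ B @ _\<close>.
\<close>

definition crossing :: "(nat list \<Rightarrow> nat list \<Rightarrow> bool) \<Rightarrow> nat \<Rightarrow> nat \<Rightarrow> nat \<Rightarrow> nat \<Rightarrow> nat \<Rightarrow> bool" where
  "crossing D h a b e f \<longleftrightarrow> (\<exists>u A B E F. strict_sorted (u @ A @ B @ E @ F) \<and> length u = h \<and>
     length A = a \<and> length B = b \<and> length E = e \<and> length F = f \<and> D (u @ A @ E) (u @ B @ F))"

definition nesting :: "(nat list \<Rightarrow> nat list \<Rightarrow> bool) \<Rightarrow> nat \<Rightarrow> nat \<Rightarrow> nat \<Rightarrow> nat \<Rightarrow> nat \<Rightarrow> bool" where
  "nesting D h a b e f \<longleftrightarrow> (\<exists>u A B E F. strict_sorted (u @ A @ B @ E @ F) \<and> length u = h \<and>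
     length A = a \<and> length B = b \<and> length E = e \<and> length F = f \<and> D (u @ A @ F) (u @ B @ E))"

text \<open>The definition asks for a single witness; canonicity makes all witnesses with the same
  block lengths agree, so a type is blue either everywhere or nowhere.\<close>

lemma crossing_iff:
  assumes "canonical K D" "strict_sorted (u @ A @ B @ E @ F)" "length (u @ A @ B @ E @ F) \<le> K"
  shows "D (u @ A @ E) (u @ B @ F) \<longleftrightarrow>
    crossing D (length u) (length A) (length B) (length E) (length F)" (is "?L \<longleftrightarrow> ?R")
proof
  show "?L \<Longrightarrow> ?R"
    unfolding crossing_def using assms(2) by blast
next
  assume ?R
  then obtain u' A' B' E' F' where *: "strict_sorted (u' @ A' @ B' @ E' @ F')"
    "length u' = length u" "length A' = length A" "length B' = length B" "length E' = length E"
    "length F' = length F" and D: "D (u' @ A' @ E') (u' @ B' @ F')"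
    unfolding crossing_def by blast
  define h a b e where "h = length u" "a = length A" "b = length B" "e = length E"
  \<comment> \<open>\<open>G\<close> and \<open>G'\<close> recover the two nodes from the
    concatenation of the blocks by lengths alone, which is why they commute with
    \<open>map\<close>.\<close>
  define G where "G w = take h w @ take a (drop h w) @ take e (drop (h + a + b) w)" for w :: "nat list"
  define G' where "G' w = take h w @ take b (drop (h + a) w) @ drop (h + a + b + e) w" for w :: "nat list"
  have "D (G (u @ A @ B @ E @ F)) (G' (u @ A @ B @ E @ F)) \<longleftrightarrow>
      D (G (u' @ A' @ B' @ E' @ F')) (G' (u' @ A' @ B' @ E' @ F'))"
  proof (rule canonical_natural[OF assms(1)])
    show "set (G w) \<union> set (G' w) \<subseteq> set w" for w
      unfolding G_def G'_def by (auto dest: in_set_takeD in_set_dropD)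
  qed (use assms * in \<open>auto simp: G_def G'_def take_map drop_map\<close>)
  then show ?L
    using D * by (simp add: G_def G'_def h_a_b_e_def)
qed

lemma nesting_iff:
  assumes "canonical K D" "strict_sorted (u @ A @ B @ E @ F)" "length (u @ A @ B @ E @ F) \<le> K"
  shows "D (u @ A @ F) (u @ B @ E) \<longleftrightarrow>
    nesting D (length u) (length A) (length B) (length E) (length F)" (is "?L \<longleftrightarrow> ?R")
proof
  show "?L \<Longrightarrow> ?R"
    unfolding nesting_def using assms(2) by blast
next
  assume ?R
  then obtain u' A' B' E' F' where *: "strict_sorted (u' @ A' @ B' @ E' @ F')"
    "length u' = length u" "length A' = length A" "length B' = length B" "length E' = length E"
    "length F' = length F" and D: "D (u' @ A' @ F') (u' @ B' @ E')"
    unfolding nesting_def by blast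
  define h a b e where "h = length u" "a = length A" "b = length B" "e = length E"
  define G where "G w = take h w @ take a (drop h w) @ drop (h + a + b + e) w" for w :: "nat list"
  define G' where "G' w = take h w @ take (b + e) (drop (h + a) w)" for w :: "nat list"
  have "D (G (u @ A @ B @ E @ F)) (G' (u @ A @ B @ E @ F)) \<longleftrightarrow>
      D (G (u' @ A' @ B' @ E' @ F')) (G' (u' @ A' @ B' @ E' @ F'))"
  proof (rule canonical_natural[OF assms(1)])
    show "set (G w) \<union> set (G' w) \<subseteq> set w" for w
      unfolding G_def G'_def by (auto dest: in_set_takeD in_set_dropD)
  qed (use assms * in \<open>auto simp: G_def G'_def take_map drop_map\<close>)
  then show ?L
    using D * by (simp add: G_def G'_def h_a_b_e_def)
qed

section \<open>Blue cliques from a type that is blue for many lengths\<close>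

lemma finite_lists_bound:
  assumes "finite Z"
  shows "\<exists>M\<ge>M0. \<forall>z\<in>Z. \<forall>x\<in>set z. x < (M :: nat)"
proof -
  have "finite (\<Union>z\<in>Z. set z)"
    using assms by auto
  then obtain M where "\<forall>x\<in>(\<Union>z\<in>Z. set z). x < M"
    using finite_nat_set_iff_bounded by auto
  then show ?thesis
    by (intro exI[of _ "max M M0"]) (auto simp: less_max_iff_disj)
qed

text \<open>The clique grows from the far end of a chain with branching lengths \<open>h\<close>. A
  step first fixes the continuation of the chain from \<open>v\<close> to \<open>v @ s\<close>; the
  node that leaves the chain at \<open>v\<close> is chosen only when the finite set \<open>Z\<close>
  of nodes extending \<open>v @ s\<close> is known, so its entries may exceed all entries of
  \<open>Z\<close>.\<close>

lemma clique_chain: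
  fixes h sz :: "nat \<Rightarrow> nat" and D :: "nat list \<Rightarrow> nat list \<Rightarrow> bool"
  assumes symD: "\<And>x y. D x y \<Longrightarrow> D y x" and irr: "\<And>x. \<not> D x x"
    and step: "\<And>a v. a < m \<Longrightarrow> strict_sorted v \<Longrightarrow> length v = h a \<Longrightarrow>
      \<exists>s. strict_sorted (v @ s) \<and> length (v @ s) = h (Suc a) \<and>
       (\<forall>Z. finite Z \<longrightarrow> (\<forall>z\<in>Z. strict_sorted z \<and> (\<exists>t. z = v @ s @ t) \<and> length z \<in> sz ` {a<..<m}) \<longrightarrow>
          (\<exists>t. strict_sorted (v @ t) \<and> length (v @ t) = sz a \<and> (\<forall>z\<in>Z. D (v @ t) z)))"
  shows "\<exists>Z. finite Z \<and> card Z = m \<and> (\<forall>z\<in>Z. strict_sorted z \<and> length z \<in> sz ` {..<m}) \<and>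
    (\<forall>x\<in>Z. \<forall>y\<in>Z. x \<noteq> y \<longrightarrow> D x y)"
proof -
  have *: "\<exists>Z. finite Z \<and> card Z = m - a \<and>
      (\<forall>z\<in>Z. strict_sorted z \<and> (\<exists>t. z = v @ t) \<and> length z \<in> sz ` {a..<m}) \<and>
      (\<forall>x\<in>Z. \<forall>y\<in>Z. x \<noteq> y \<longrightarrow> D x y)"
    if "a \<le> m" "strict_sorted v" "length v = h a" for a v
    using that
  proof (induction a arbitrary: v rule: inc_induct)
    case base
    then show ?case
      by (intro exI[of _ "{}"]) auto
  next
    case (step a)
    obtain s where s: "strict_sorted (v @ s)" "length (v @ s) = h (Suc a)"
      and ext: "\<And>Z. finite Z \<Longrightarrow>
        (\<forall>z\<in>Z. strict_sorted z \<and> (\<exists>t. z = v @ s @ t) \<and> length z \<in> sz ` {a<..<m}) \<Longrightarrow>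
          (\<exists>t. strict_sorted (v @ t) \<and> length (v @ t) = sz a \<and> (\<forall>z\<in>Z. D (v @ t) z))"
      using assms(3)[OF step.hyps(2) step.prems] by blast
    obtain Z where Z: "finite Z" "card Z = m - Suc a"
      "\<And>z. z \<in> Z \<Longrightarrow> strict_sorted z \<and> (\<exists>t. z = v @ s @ t) \<and> length z \<in> sz ` {Suc a..<m}"
      "\<And>x y. x \<in> Z \<Longrightarrow> y \<in> Z \<Longrightarrow> x \<noteq> y \<Longrightarrow> D x y"
      using step.IH[OF s] by auto
    obtain t where t: "strict_sorted (v @ t)" "length (v @ t) = sz a" "\<And>z. z \<in> Z \<Longrightarrow> D (v @ t) z"
      using ext[OF Z(1)] Z(3) by (metis atLeastSucLessThan_greaterThanLessThan)
    have "v @ t \<notin> Z"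
      using t(3) irr by blast
    then show ?case
    proof (intro exI[of _ "insert (v @ t) Z"] conjI)
      show "card (insert (v @ t) Z) = m - a"
        using \<open>v @ t \<notin> Z\<close> Z(1,2) step.hyps by simp
      show "\<forall>z\<in>insert (v @ t) Z. strict_sorted z \<and> (\<exists>t. z = v @ t) \<and> length z \<in> sz ` {a..<m}"
      proof
        fix z assume "z \<in> insert (v @ t) Z"
        then show "strict_sorted z \<and> (\<exists>t. z = v @ t) \<and> length z \<in> sz ` {a..<m}"
        proof
          assume "z = v @ t"
          then show ?thesis
            using t(1,2) step.hyps(2) by auto
        next
          assume "z \<in> Z"
          moreover have "{Suc a..<m} \<subseteq> {a..<m}"
            by auto
          ultimately show ?thesis
            using Z(3) by blast
        qed
      qed
      show "\<forall>x\<in>insert (v @ t) Z. \<forall>y\<in>insert (v @ t) Z. x \<noteq> y \<longrightarrow> D x y"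
        using t(3) Z(4) symD by blast
    qed (use Z(1) in auto)
  qed
  have "strict_sorted [0..<h 0]"
    by simp
  then show ?thesis
    using *[of 0 "[0..<h 0]"] by (fastforce simp: lessThan_atLeast0)
qed

text \<open>The node leaving at \<open>v\<close> is \<open>v @ A @ F\<close>, with \<open>A\<close>
  before the continuation of the chain and \<open>F\<close> beyond all entries of \<open>Z\<close>.
  A later node is \<open>v @ B @ E\<close> with \<open>B\<close> and \<open>E\<close> adjacent, so
  only the length of \<open>B @ E\<close> matters; hence \<open>nest\<close> may choose the cut into
  \<open>p\<close> and \<open>q\<close>. Together \<open>v\<close> and the four blocks have length
  at most \<open>sz a + sz b\<close>.\<close>

lemma nesting_clique:
  assumes can: "canonical K D" and symD: "\<And>x y. D x y \<Longrightarrow> D y x" and irr: "\<And>x. \<not> D x x"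
    and h: "\<And>a. a < m \<Longrightarrow> h a < h (Suc a)" "\<And>a. a < m \<Longrightarrow> h a + \<alpha> a \<le> sz a"
    and K: "\<And>a b. a < m \<Longrightarrow> b < m \<Longrightarrow> sz a + sz b \<le> K"
    and nest: "\<And>a b. a < b \<Longrightarrow> b < m \<Longrightarrow>
      \<exists>p q. p + q = sz b - h a \<and> nesting D (h a) (\<alpha> a) p q (sz a - h a - \<alpha> a)"
  shows "\<exists>Z. finite Z \<and> card Z = m \<and> (\<forall>z\<in>Z. strict_sorted z \<and> length z \<in> sz ` {..<m}) \<and>
    (\<forall>x\<in>Z. \<forall>y\<in>Z. x \<noteq> y \<longrightarrow> D x y)"
proof (rule clique_chain[where h = h, OF symD irr])
  fix a :: nat and v :: "nat list" assume a: "a < m" and v: "strict_sorted v" "length v = h a"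
  obtain M where M: "\<And>x. x \<in> set v \<Longrightarrow> x < M"
    using finite_lists_bound[of "{v}" 0] by auto
  define A where "A = [M..<M + \<alpha> a]"
  define s where "s = [M + \<alpha> a..<M + \<alpha> a + (h (Suc a) - h a)]"
  have c1: "strict_sorted (v @ s)"
    using v(1) by (auto simp: s_def sorted_wrt_append dest!: M)
  have c2: "length (v @ s) = h (Suc a)"
    using v h(1)[OF a] by (simp add: s_def)
  have c3: "\<exists>t. strict_sorted (v @ t) \<and> length (v @ t) = sz a \<and> (\<forall>z\<in>Z. D (v @ t) z)"
    if Z: "finite Z" "\<And>z. z \<in> Z \<Longrightarrow> strict_sorted z \<and> (\<exists>t. z = v @ s @ t) \<and> length z \<in> sz ` {a<..<m}" for Z
  proof -
    obtain M' where M': "M' \<ge> M + \<alpha> a" "\<And>z x. z \<in> Z \<Longrightarrow> x \<in> set z \<Longrightarrow> x < M'"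
      using finite_lists_bound[OF Z(1), of "M + \<alpha> a"] by auto
    define F where "F = [M'..<M' + (sz a - h a - \<alpha> a)]"
    have "D (v @ A @ F) z" if z: "z \<in> Z" for z
    proof -
      obtain t where t: "z = v @ s @ t" "strict_sorted z"
        using Z(2) z by blast
      obtain b where b: "a < b" "b < m" "length z = sz b"
        using Z(2)[OF z] by auto
      obtain p q where pq: "p + q = sz b - h a" "nesting D (h a) (\<alpha> a) p q (sz a - h a - \<alpha> a)"
        using nest[OF b(1,2)] by blast
      have "length (s @ t) = p + q"
        using pq(1) b(3) v(2) t(1) by simp
      then obtain B E where BE: "s @ t = B @ E" "length B = p" "length E = q"
        by (metis append_take_drop_id length_take length_drop add_diff_cancel_left' min.absorb2 le_add1)
      \<comment> \<open>\<open>s\<close> is nonempty because \<open>h\<close> increases, and the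
        entries of \<open>t\<close> follow those of \<open>s\<close>, so they too lie beyond
        \<open>A\<close>.\<close>
      have tg: "M + \<alpha> a \<le> x" if "x \<in> set t" for x
      proof -
        have "s \<noteq> []"
          using h(1)[OF a] by (simp add: s_def)
        then have "M + \<alpha> a \<in> set s"
          by (auto simp: s_def)
        with that t show ?thesis
          by (auto simp: sorted_wrt_append intro: less_imp_le)
      qed
      define r where "r = s @ t"
      have st: "strict_sorted r" "\<And>x. x \<in> set r \<Longrightarrow> M + \<alpha> a \<le> x \<and> x < M'"
        using t tg M'(2)[OF z] by (auto simp: r_def sorted_wrt_append s_def)
      have "strict_sorted (v @ A @ (s @ t) @ F)"
        unfolding r_def[symmetric] using v(1) st(1) M'(1)
        by (auto simp: sorted_wrt_append A_def F_def dest!: M st(2))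
      then have "strict_sorted (v @ A @ B @ E @ F)"
        unfolding BE(1) by simp
      moreover have "length (v @ A @ B @ E @ F) \<le> K"
        using BE(2,3) K[OF a b(2)] pq(1) b(3) v(2) t(1) h(2)[OF a] by (auto simp: A_def F_def)
      ultimately have "D (v @ A @ F) (v @ B @ E)"
        using nesting_iff[OF can, of v A B E F] pq(2) BE(2,3) v(2) by (simp add: A_def F_def)
      then show ?thesis
        using t(1) BE(1) by simp
    qed
    moreover have "strict_sorted (v @ A @ F)"
      using v(1) M'(1) by (auto simp: sorted_wrt_append A_def F_def dest!: M)
    moreover have "length (v @ A @ F) = sz a"
      using v(2) h(2)[OF a] by (simp add: A_def F_def)
    ultimately show ?thesis
      by blast
  qed
  show "\<exists>s. strict_sorted (v @ s) \<and> length (v @ s) = h (Suc a) \<and>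
       (\<forall>Z. finite Z \<longrightarrow> (\<forall>z\<in>Z. strict_sorted z \<and> (\<exists>t. z = v @ s @ t) \<and> length z \<in> sz ` {a<..<m}) \<longrightarrow>
          (\<exists>t. strict_sorted (v @ t) \<and> length (v @ t) = sz a \<and> (\<forall>z\<in>Z. D (v @ t) z)))"
    by (rule exI[of _ "s"], rule conjI[OF c1], rule conjI[OF c2], intro allI impI, rule c3) auto
qed

text \<open>Here the chain itself runs through \<open>B\<close>, and the tail \<open>E\<close> of
  the leaving node is placed between \<open>B\<close> and the rest of the chain. Every later node
  then has \<open>B\<close> as its first block and its remaining entries after \<open>E\<close>, so
  the leaving node can be fixed before \<open>Z\<close> is known.\<close>

lemma crossing_clique:
  assumes can: "canonical K D" and symD: "\<And>x y. D x y \<Longrightarrow> D y x" and irr: "\<And>x. \<not> D x x"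
    and h: "\<And>a. a < m \<Longrightarrow> h a + \<beta> a < h (Suc a)" "\<And>a. a < m \<Longrightarrow> h a + \<alpha> a \<le> sz a"
    and K: "\<And>a b. a < m \<Longrightarrow> b < m \<Longrightarrow> sz a + sz b \<le> K"
    and cross: "\<And>a b. a < b \<Longrightarrow> b < m \<Longrightarrow>
      crossing D (h a) (\<alpha> a) (\<beta> a) (sz a - h a - \<alpha> a) (sz b - h a - \<beta> a)"
  shows "\<exists>Z. finite Z \<and> card Z = m \<and> (\<forall>z\<in>Z. strict_sorted z \<and> length z \<in> sz ` {..<m}) \<and>
    (\<forall>x\<in>Z. \<forall>y\<in>Z. x \<noteq> y \<longrightarrow> D x y)"
proof (rule clique_chain[where h = h, OF symD irr])
  fix a :: nat and v :: "nat list" assume a: "a < m" and v: "strict_sorted v" "length v = h a"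
  obtain M where M: "\<And>x. x \<in> set v \<Longrightarrow> x < M"
    using finite_lists_bound[of "{v}" 0] by auto
  define M' where "M' = M + \<alpha> a + \<beta> a + (sz a - h a - \<alpha> a)"
  define A where "A = [M..<M + \<alpha> a]"
  define B where "B = [M + \<alpha> a..<M + \<alpha> a + \<beta> a]"
  define E where "E = [M + \<alpha> a + \<beta> a..<M']"
  define s where "s = [M'..<M' + (h (Suc a) - h a - \<beta> a)]"
  have c1: "strict_sorted (v @ B @ s)"
    using v(1) by (auto simp: B_def s_def M'_def sorted_wrt_append dest!: M)
  have c2: "length (v @ B @ s) = h (Suc a)"
    using v h(1)[OF a] by (simp add: s_def B_def)
  have c3: "\<exists>t. strict_sorted (v @ t) \<and> length (v @ t) = sz a \<and> (\<forall>z\<in>Z. D (v @ t) z)"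
    if Z: "finite Z" "\<And>z. z \<in> Z \<Longrightarrow> strict_sorted z \<and> (\<exists>t. z = v @ (B @ s) @ t) \<and> length z \<in> sz ` {a<..<m}" for Z
  proof -
    have "D (v @ A @ E) z" if z: "z \<in> Z" for z
    proof -
      obtain t where t: "z = v @ B @ s @ t" "strict_sorted z"
        using Z(2)[OF z] by auto
      obtain b where b: "a < b" "b < m" "length z = sz b"
        using Z(2)[OF z] by auto
      have tg: "M' \<le> x" if "x \<in> set t" for x
      proof -
        have "s \<noteq> []"
          using h(1)[OF a] by (simp add: s_def)
        then have "M' \<in> set s"
          by (auto simp: s_def)
        with that t show ?thesis
          by (auto simp: sorted_wrt_append intro: less_imp_le)
      qed
      have M2: "M + \<alpha> a + \<beta> a \<le> M'"
        by (simp add: M'_def)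
      define r where "r = s @ t"
      have st: "strict_sorted r" "\<And>x. x \<in> set r \<Longrightarrow> M' \<le> x"
        using t tg by (auto simp: r_def sorted_wrt_append s_def)
      have "strict_sorted (v @ A @ B @ E @ (s @ t))"
        unfolding r_def[symmetric] using v(1) st(1) M2
        by (auto simp: sorted_wrt_append A_def B_def E_def dest!: M st(2))
      moreover have "length (v @ A @ B @ E @ (s @ t)) \<le> K"
        using K[OF a b(2)] b(3) v(2) t(1) h(2)[OF a] by (auto simp: A_def E_def M'_def)
      ultimately have "D (v @ A @ E) (v @ B @ (s @ t)) \<longleftrightarrow>
          crossing D (length v) (length A) (length B) (length E) (length (s @ t))"
        by (rule crossing_iff[OF can])
      moreover have "length (s @ t) = sz b - h a - \<beta> a"
        using t(1) b(3) v(2) by (simp add: B_def)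
      ultimately show ?thesis
        using cross[OF b(1,2)] v(2) t(1) by (simp add: A_def B_def E_def M'_def)
    qed
    moreover have "strict_sorted (v @ A @ E)"
      using v(1) by (auto simp: sorted_wrt_append A_def E_def dest!: M)
    moreover have "length (v @ A @ E) = sz a"
      using v(2) h(2)[OF a] by (simp add: A_def E_def M'_def)
    ultimately show ?thesis
      by blast
  qed
  show "\<exists>s. strict_sorted (v @ s) \<and> length (v @ s) = h (Suc a) \<and>
       (\<forall>Z. finite Z \<longrightarrow> (\<forall>z\<in>Z. strict_sorted z \<and> (\<exists>t. z = v @ s @ t) \<and> length z \<in> sz ` {a<..<m}) \<longrightarrow>
          (\<exists>t. strict_sorted (v @ t) \<and> length (v @ t) = sz a \<and> (\<forall>z\<in>Z. D (v @ t) z)))"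
    by (rule exI[of _ "B @ s"], rule conjI[OF c1], rule conjI[OF c2], intro allI impI, rule c3) auto
qed

text \<open>Consecutive intervals of length \<open>a\<close> after one prefix realise this type
  pairwise, and there are infinitely many of them, so one blue instance gives cliques of every
  size.\<close>

lemma sibling_clique:
  assumes can: "canonical K D" and symD: "\<And>x y. D x y \<Longrightarrow> D y x"
    and nest: "nesting D h a a 0 0" and a: "a > 0" and K: "h + 2 * a \<le> K"
  shows "\<exists>Z. finite Z \<and> card Z = m \<and> (\<forall>z\<in>Z. strict_sorted z \<and> length z = h + a) \<and>
    (\<forall>x\<in>Z. \<forall>y\<in>Z. x \<noteq> y \<longrightarrow> D x y)"
proof -
  define z where "z t = [0..<h] @ [h + t * a..<h + t * a + a]" for t
  have D: "D (z t) (z t')" if "t < t'" for t t'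
  proof -
    let ?A = "[h + t * a..<h + t * a + a]" and ?B = "[h + t' * a..<h + t' * a + a]"
    have "t * a + a \<le> t' * a"
      using that by (metis Suc_leI add.commute mult_Suc mult_le_mono1)
    then have "strict_sorted ([0..<h] @ ?A @ ?B @ [] @ [])"
      by (auto simp: sorted_wrt_append)
    then show ?thesis
      using nesting_iff[OF can, of "[0..<h]" ?A ?B "[]" "[]"] nest K
      by (simp add: z_def)
  qed
  have "inj z"
    using a by (auto simp: inj_def z_def upt_conv_Cons)
  then have "card (z ` {..<m}) = m"
    by (metis card_image card_lessThan inj_on_subset subset_UNIV)
  moreover have "D x y" if "x \<in> z ` {..<m}" "y \<in> z ` {..<m}" "x \<noteq> y" for x y
    using that D symD by (metis imageE linorder_neqE_nat)
  moreover have "strict_sorted (z t)" "length (z t) = h + a" for t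
    by (auto simp: z_def sorted_wrt_append)
  ultimately show ?thesis
    by (intro exI[of _ "z ` {..<m}"]) auto
qed

text \<open>
  The types of the pairs top and limit point, top and further point, limit point and further point
  above the same prefix; limit point and later further point; further point and later limit point, in
  separate blocks; and the interleaved pairs. Pairs of siblings are missing, since these are
  automatically red (see \<open>sibling_clique\<close>).
\<close>

definition bad :: "(nat list \<Rightarrow> nat list \<Rightarrow> bool) \<Rightarrow> nat \<Rightarrow> nat \<Rightarrow> nat \<Rightarrow> nat \<Rightarrow> bool" where
  "bad D t h i j =
    [nesting D h 0 (i - h) 0 0, nesting D h 0 (j - h) 0 0, nesting D i 0 (j - i) 0 0,
     nesting D h (i - h) (j - h) 0 0, nesting D h (j - h) (i - h) 0 0,
     nesting D h (i - h) (i - h) (j - i) (j - i), crossing D h 0 (i - h) (i - h) (j - i),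
     crossing D h (i - h) (i - h) (j - i) (j - i)] ! t"

text \<open>Each clique node consumes up to two lengths, typically \<open>l ! (2 * a)\<close> for
  the branching and \<open>l ! (2 * a + 1)\<close> for a block or the node itself. The two further
  entries of \<open>l\<close> provide a length \<open>l ! (2 * m)\<close> beyond all of these and,
  for type 0, a third argument of \<open>bad\<close>.\<close>

lemma bad_clique:
  assumes can: "canonical (2 * N) D" and symD: "\<And>x y. D x y \<Longrightarrow> D y x" and irr: "\<And>x. \<not> D x x"
    and l: "strict_sorted l" "length l = 2 * m + 2" "\<And>x. x < length l \<Longrightarrow> l ! x \<le> N"
    and t: "t < 8"
    and bad: "\<And>x y z. x < y \<Longrightarrow> y < z \<Longrightarrow> z < length l \<Longrightarrow> bad D t (l ! x) (l ! y) (l ! z)"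
  shows "\<exists>Z. finite Z \<and> card Z = m \<and> (\<forall>z\<in>Z. strict_sorted z \<and> length z \<le> N) \<and>
    (\<forall>x\<in>Z. \<forall>y\<in>Z. x \<noteq> y \<longrightarrow> D x y)"
proof -
  have lt: "l ! x < l ! y" if "x < y" "y < 2 * m + 2" for x y
    using l(1,2) that sorted_wrt_nth_less by metis
  have le: "l ! x \<le> l ! y" if "x \<le> y" "y < 2 * m + 2" for x y
    using lt[of x y] that by (cases "x = y") auto
  have N: "l ! x \<le> N" if "x < 2 * m + 2" for x
    using l(2,3) that by simp
  have N2: "l ! x + l ! y \<le> 2 * N" if "x < 2 * m + 2" "y < 2 * m + 2" for x y
    using N[OF that(1)] N[OF that(2)] by simp
  note bad = bad[unfolded l(2) bad_def]
  have fin: ?thesis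
    if clique: "\<exists>Z. finite Z \<and> card Z = m \<and> (\<forall>z\<in>Z. strict_sorted z \<and> length z \<in> (\<lambda>a. l ! sz a) ` {..<m}) \<and>
      (\<forall>x\<in>Z. \<forall>y\<in>Z. x \<noteq> y \<longrightarrow> D x y)" and sz: "\<And>a. a < m \<Longrightarrow> sz a < 2 * m + 2" for sz
  proof -
    have "n \<le> N" if "n \<in> (\<lambda>a. l ! sz a) ` {..<m}" for n
      using that N sz by blast
    then show ?thesis
      using clique by (elim exE) (intro exI, auto)
  qed
  note nc = nesting_clique[OF can symD irr] and cc = crossing_clique[OF can symD irr]
  consider "t = 0" | "t = 1" | "t = 2" | "t = 3" | "t = 4" | "t = 5" | "t = 6" | "t = 7"
    using t by linarith
  then show ?thesis
  proof cases
    case 1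
    note bad = bad[unfolded 1, simplified]
    show ?thesis
    proof (rule fin[where sz = "\<lambda>a. a"], rule nc[where h = "\<lambda>a. l ! a" and \<alpha> = "\<lambda>_. 0"])
      show "\<exists>p q. p + q = l ! b - l ! a \<and> nesting D (l ! a) 0 p q (l ! a - l ! a - 0)"
        if "a < b" "b < m" for a b
        using bad[of a b "2 * m + 1"] that by (intro exI[of _ "l ! b - l ! a"] exI[of _ 0]) simp
    qed (auto intro!: lt N N2)
  next
    case 2
    note bad = bad[unfolded 2, simplified]
    show ?thesis
    proof (rule fin[where sz = "\<lambda>a. 2 * a"], rule nc[where h = "\<lambda>a. l ! (2 * a)" and \<alpha> = "\<lambda>_. 0"])
      show "\<exists>p q. p + q = l ! (2 * b) - l ! (2 * a) \<and>
          nesting D (l ! (2 * a)) 0 p q (l ! (2 * a) - l ! (2 * a) - 0)"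
        if "a < b" "b < m" for a b
        using bad[of "2 * a" "2 * a + 1" "2 * b"] that
        by (intro exI[of _ "l ! (2 * b) - l ! (2 * a)"] exI[of _ 0]) simp
    qed (auto intro!: lt N N2)
  next
    case 3
    note bad = bad[unfolded 3, simplified]
    show ?thesis
    proof (rule fin[where sz = "\<lambda>a. a + 1"], rule nc[where h = "\<lambda>a. l ! (a + 1)" and \<alpha> = "\<lambda>_. 0"])
      show "\<exists>p q. p + q = l ! (b + 1) - l ! (a + 1) \<and>
          nesting D (l ! (a + 1)) 0 p q (l ! (a + 1) - l ! (a + 1) - 0)"
        if "a < b" "b < m" for a b
        \<comment> \<open>Type 2 relates only the two larger lengths; index 0 is kept for the
          smallest one, so the chain starts at index 1.\<close>
        using bad[of 0 "a + 1" "b + 1"] that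
        by (intro exI[of _ "l ! (b + 1) - l ! (a + 1)"] exI[of _ 0]) simp
    qed (auto intro!: lt N N2)
  next
    case 4
    note bad = bad[unfolded 4, simplified]
    show ?thesis
    proof (rule fin[where sz = "\<lambda>a. 2 * a + 1"], rule nc[where h = "\<lambda>a. l ! (2 * a)"
          and \<alpha> = "\<lambda>a. l ! (2 * a + 1) - l ! (2 * a)"])
      show "\<exists>p q. p + q = l ! (2 * b + 1) - l ! (2 * a) \<and>
          nesting D (l ! (2 * a)) (l ! (2 * a + 1) - l ! (2 * a)) p q
            (l ! (2 * a + 1) - l ! (2 * a) - (l ! (2 * a + 1) - l ! (2 * a)))"
        if "a < b" "b < m" for a b
        using bad[of "2 * a" "2 * a + 1" "2 * b + 1"] that
        by (intro exI[of _ "l ! (2 * b + 1) - l ! (2 * a)"] exI[of _ 0]) simp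
      show "l ! (2 * a) + (l ! (2 * a + 1) - l ! (2 * a)) \<le> l ! (2 * a + 1)" if "a < m" for a
        using le[of "2 * a" "2 * a + 1"] that by simp
    qed (auto intro!: lt N N2)
  next
    case 5
    note bad = bad[unfolded 5, simplified]
    \<comment> \<open>In type 4 the node with the earlier block is the longer one, so the node
      lengths decrease while the branching lengths increase; \<open>a < b < m\<close> gives
      \<open>a < 2 * m - b < 2 * m - a\<close>.\<close>
    show ?thesis
    proof (rule fin[where sz = "\<lambda>a. 2 * m - a"], rule nc[where h = "\<lambda>a. l ! a"
          and \<alpha> = "\<lambda>a. l ! (2 * m - a) - l ! a"])
      show "\<exists>p q. p + q = l ! (2 * m - b) - l ! a \<and>
          nesting D (l ! a) (l ! (2 * m - a) - l ! a) p q
            (l ! (2 * m - a) - l ! a - (l ! (2 * m - a) - l ! a))"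
        if "a < b" "b < m" for a b
        using bad[of a "2 * m - b" "2 * m - a"] that
        by (intro exI[of _ "l ! (2 * m - b) - l ! a"] exI[of _ 0]) simp
      show "l ! a + (l ! (2 * m - a) - l ! a) \<le> l ! (2 * m - a)" if "a < m" for a
        using le[of a "2 * m - a"] that by simp
    qed (auto intro!: lt N N2)
  next
    case 6
    note bad = bad[unfolded 6, simplified]
    \<comment> \<open>Both nodes of type 5 have the same length, so all clique nodes get the length
      \<open>l ! (2 * m)\<close>; the middle length of a triple says where the first block
      ends.\<close>
    show ?thesis
    proof (rule fin[where sz = "\<lambda>a. 2 * m"], rule nc[where h = "\<lambda>a. l ! (2 * a)"
          and \<alpha> = "\<lambda>a. l ! (2 * a + 1) - l ! (2 * a)"])
      fix a b assume ab: "a < b" "b < m"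
      have "l ! (2 * a) \<le> l ! (2 * a + 1)" "l ! (2 * a + 1) \<le> l ! (2 * m)"
        using le ab by auto
      then show "\<exists>p q. p + q = l ! (2 * m) - l ! (2 * a) \<and>
          nesting D (l ! (2 * a)) (l ! (2 * a + 1) - l ! (2 * a)) p q
            (l ! (2 * m) - l ! (2 * a) - (l ! (2 * a + 1) - l ! (2 * a)))"
        using bad[of "2 * a" "2 * a + 1" "2 * m"] ab
        by (intro exI[of _ "l ! (2 * a + 1) - l ! (2 * a)"] exI[of _ "l ! (2 * m) - l ! (2 * a + 1)"]) simp
    next
      fix a assume "a < m"
      then show "l ! (2 * a) + (l ! (2 * a + 1) - l ! (2 * a)) \<le> l ! (2 * m)"
        using le[of "2 * a" "2 * a + 1"] le[of "2 * a + 1" "2 * m"] by simp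
    qed (auto intro!: lt N N2)
  next
    case 7
    note bad = bad[unfolded 7, simplified]
    show ?thesis
    proof (rule fin[where sz = "\<lambda>a. 2 * a + 1"], rule cc[where h = "\<lambda>a. l ! (2 * a)"
          and \<alpha> = "\<lambda>a. 0" and \<beta> = "\<lambda>a. l ! (2 * a + 1) - l ! (2 * a)"])
      fix a b assume ab: "a < b" "b < m"
      have "l ! (2 * a) \<le> l ! (2 * a + 1)"
        using le ab by auto
      then show "crossing D (l ! (2 * a)) 0 (l ! (2 * a + 1) - l ! (2 * a))
            (l ! (2 * a + 1) - l ! (2 * a) - 0)
            (l ! (2 * b + 1) - l ! (2 * a) - (l ! (2 * a + 1) - l ! (2 * a)))"
        using bad[of "2 * a" "2 * a + 1" "2 * b + 1"] ab by simp
    next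
      fix a assume "a < m"
      then show "l ! (2 * a) + (l ! (2 * a + 1) - l ! (2 * a)) < l ! (2 * Suc a)"
        using le[of "2 * a" "2 * a + 1"] lt[of "2 * a + 1" "2 * Suc a"] by simp
      show "l ! (2 * a) + 0 \<le> l ! (2 * a + 1)"
        using le[of "2 * a" "2 * a + 1"] \<open>a < m\<close> by simp
    qed (auto intro!: N N2)
  next
    case 8
    note bad = bad[unfolded 8, simplified]
    show ?thesis
    proof (rule fin[where sz = "\<lambda>a. 2 * m"], rule cc[where h = "\<lambda>a. l ! (2 * a)"
          and \<alpha> = "\<lambda>a. l ! (2 * a + 1) - l ! (2 * a)" and \<beta> = "\<lambda>a. l ! (2 * a + 1) - l ! (2 * a)"])
      fix a b assume ab: "a < b" "b < m"
      have "l ! (2 * a) \<le> l ! (2 * a + 1)" "l ! (2 * a + 1) \<le> l ! (2 * m)"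
        using le ab by auto
      then show "crossing D (l ! (2 * a)) (l ! (2 * a + 1) - l ! (2 * a)) (l ! (2 * a + 1) - l ! (2 * a))
            (l ! (2 * m) - l ! (2 * a) - (l ! (2 * a + 1) - l ! (2 * a)))
            (l ! (2 * m) - l ! (2 * a) - (l ! (2 * a + 1) - l ! (2 * a)))"
        using bad[of "2 * a" "2 * a + 1" "2 * m"] ab by simp
    next
      fix a assume "a < m"
      then show "l ! (2 * a) + (l ! (2 * a + 1) - l ! (2 * a)) < l ! (2 * Suc a)"
        using le[of "2 * a" "2 * a + 1"] lt[of "2 * a + 1" "2 * Suc a"] by simp
      show "l ! (2 * a) + (l ! (2 * a + 1) - l ! (2 * a)) \<le> l ! (2 * m)"
        using le[of "2 * a" "2 * a + 1"] le[of "2 * a + 1" "2 * m"] \<open>a < m\<close> by simp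
    qed (auto intro!: N N2)
  qed
qed

text \<open>Triples of lengths are coloured by 0 if good, where one triple is enough, and otherwise
  by a blue type shifted by one, where \<open>bad_clique\<close> needs \<open>2 * m + 2\<close>
  lengths. A Ramsey number for these sizes serves as the bound on the lengths of nodes.\<close>

lemma good_triple_or_clique:
  "\<exists>N. \<forall>D. canonical (2 * N) D \<longrightarrow> (\<forall>x y. D x y \<longrightarrow> D y x) \<longrightarrow> (\<forall>x. \<not> D x x) \<longrightarrow>
     (\<exists>h i j. h < i \<and> i < j \<and> j \<le> N \<and> (\<forall>t<8. \<not> bad D t h i j)) \<or>
     (\<exists>Z. finite Z \<and> card Z = m \<and> (\<forall>z\<in>Z. strict_sorted z \<and> length z \<le> N) \<and>
       (\<forall>x\<in>Z. \<forall>y\<in>Z. x \<noteq> y \<longrightarrow> D x y))"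
proof -
  obtain N :: nat where N: "partn_lst {..<N} (3 # replicate 8 (2 * m + 2)) 3"
    using ramsey_full by blast
  have "(\<exists>h i j. h < i \<and> i < j \<and> j \<le> N \<and> (\<forall>t<8. \<not> bad D t h i j)) \<or>
     (\<exists>Z. finite Z \<and> card Z = m \<and> (\<forall>z\<in>Z. strict_sorted z \<and> length z \<le> N) \<and>
       (\<forall>x\<in>Z. \<forall>y\<in>Z. x \<noteq> y \<longrightarrow> D x y))" (is "?triple \<or> ?clique")
    if can: "canonical (2 * N) D" and D: "\<forall>x y. D x y \<longrightarrow> D y x" "\<forall>x. \<not> D x x" for D
  proof (cases ?triple)
    case none: False
    define f where "f X = Suc (SOME t. t < 8 \<and> bad D t (sorted_list_of_set X ! 0)
      (sorted_list_of_set X ! 1) (sorted_list_of_set X ! 2))" for X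
    have f: "f {h, i, j} \<noteq> 0 \<and> f {h, i, j} < 9 \<and> bad D (f {h, i, j} - 1) h i j"
      if "h < i" "i < j" "j < N" for h i j
    proof -
      have s: "sorted_list_of_set {h, i, j} = [h, i, j]"
        using that sorted_list_of_set.idem_if_sorted_distinct[of "[h, i, j]"] by simp
      have "\<exists>t. t < 8 \<and> bad D t h i j"
        using none that by (meson less_imp_le)
      from someI_ex[OF this] show ?thesis
        unfolding f_def s by simp
    qed
    have "f \<in> nsets {..<N} 3 \<rightarrow> {..<length (3 # replicate 8 (2 * m + 2))}"
    proof
      fix X assume "X \<in> nsets {..<N} 3"
      then obtain x y z where "X = {x, y, z}" "x < y" "y < z" "z < N"
        unfolding ordered_nsets_3_eq by auto
      then show "f X \<in> {..<length (3 # replicate 8 (2 * m + 2))}"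
        using f[of x y z] by simp
    qed
    then obtain c H where c: "c < length (3 # replicate 8 (2 * m + 2))"
      "H \<in> nsets {..<N} ((3 # replicate 8 (2 * m + 2)) ! c)" "f ` nsets H 3 \<subseteq> {c}"
      using N unfolding partn_lst_def monochromatic_def by blast
    have H: "finite H" "H \<subseteq> {..<N}" "card H = (3 # replicate 8 (2 * m + 2)) ! c"
      using c(2) by (auto simp: nsets_def)
    define l where "l = sorted_list_of_set H"
    have l: "strict_sorted l" "set l = H" "length l = card H"
      using H(1) by (auto simp: l_def)
    have lH: "l ! x \<in> H" "l ! x < N" if "x < length l" for x
      using that l(2) H(2) by auto
    have lt: "l ! x < l ! y" if "x < y" "y < length l" for x y
      using l(1) that sorted_wrt_nth_less by metis
    have fl: "f {l ! x, l ! y, l ! z} = c \<and> c \<noteq> 0 \<and> bad D (c - 1) (l ! x) (l ! y) (l ! z)"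
      if "x < y" "y < z" "z < length l" for x y z
    proof -
      have "{l ! x, l ! y, l ! z} \<in> nsets H 3"
        using lH lt[of x y] lt[of y z] that unfolding ordered_nsets_3_eq by (intro CollectI exI[of _ "l ! x"] exI[of _ "l ! y"] exI[of _ "l ! z"]) auto
      then have "f {l ! x, l ! y, l ! z} = c"
        using c(3) by auto
      then show ?thesis
        using f[of "l ! x" "l ! y" "l ! z"] lt lH that by auto
    qed
    have "c \<noteq> 0"
    proof
      assume "c = 0"
      then have "length l = 3"
        using H(3) l(3) by simp
      then show False
        using fl[of 0 1 2] \<open>c = 0\<close> by simp
    qed
    then obtain t where t: "c = Suc t" "t < 8"
      using c(1) by (cases c) auto
    have "length l = 2 * m + 2"
      using H(3) l(3) t by simp
    then have ?clique
      using bad_clique[OF can _ _ l(1) _ _ t(2)] D fl lH(2) t(1) by (simp add: less_imp_le)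
    then show ?thesis ..
  qed simp
  then show ?thesis
    by blast
qed

section \<open>Red copies of \<open>\<omega>\<^sup>2 + 1\<close> in the tree\<close>

definition config :: "nat \<Rightarrow> nat list \<Rightarrow> (nat \<Rightarrow> nat list) \<Rightarrow> (nat \<Rightarrow> nat \<Rightarrow> nat list) \<Rightarrow> bool" where
  "config N v A B \<longleftrightarrow> (\<forall>n k. strict_sorted (v @ A n @ B n k) \<and> length (v @ A n @ B n k) \<le> N \<and>
     A n \<noteq> [] \<and> B n k \<noteq> []) \<and> strict_mono (\<lambda>n. hd (A n)) \<and> (\<forall>n. strict_mono (\<lambda>k. hd (B n k)))"

definition config_points :: "nat list \<Rightarrow> (nat \<Rightarrow> nat list) \<Rightarrow> (nat \<Rightarrow> nat \<Rightarrow> nat list) \<Rightarrow> nat list set" where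
  "config_points v A B = insert v (range (\<lambda>n. v @ A n) \<union> range (\<lambda>(n, k). v @ A n @ B n k))"

lemma prod_encode_strict_mono: "k < k' \<Longrightarrow> prod_encode (n, k) < prod_encode (n, k')"
proof -
  have "prod_encode (n, k) < prod_encode (n, Suc k)" for k
    by (simp add: prod_encode_def)
  then show "k < k' \<Longrightarrow> ?thesis"
    using lift_Suc_mono_less[of "\<lambda>k. prod_encode (n, k)"] by blast
qed

text \<open>Reduces sortedness of a concatenation to comparisons of whole blocks, which
  \<open>simp\<close> settles without looking at entries.\<close>

definition below :: "nat list \<Rightarrow> nat list \<Rightarrow> bool" where
  "below xs ys \<longleftrightarrow> (\<forall>x\<in>set xs. \<forall>y\<in>set ys. x < y)"

lemma below_simps [simp]:
  "below (xs @ ys) zs \<longleftrightarrow> below xs zs \<and> below ys zs"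
  "below xs (ys @ zs) \<longleftrightarrow> below xs ys \<and> below xs zs"
  "below [] xs" "below xs []"
  by (auto simp: below_def)

lemma strict_sorted_append_iff:
  "strict_sorted (xs @ ys) \<longleftrightarrow> strict_sorted xs \<and> strict_sorted ys \<and> below xs ys"
  by (auto simp: below_def sorted_wrt_append)

text \<open>The naturals are divided into slots of length \<open>j\<close>, each wide enough for one
  block; the initial one is left to \<open>v\<close>, \<open>A n\<close> takes an even slot and
  \<open>B n k\<close> the odd slot given by the Cantor code of \<open>(n, k)\<close>. Different
  blocks lie in different slots, so one is entirely below the other, and each pair of points has a
  type excluded by \<open>good\<close> or consists of nodes of equal length in separate blocks, to
  which \<open>sibling_clique\<close> applies.\<close>

lemma red_config:
  assumes can: "canonical (2 * N) D" and symD: "\<And>x y. D x y \<Longrightarrow> D y x"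
    and hij: "h < i" "i < j" "j \<le> N" and good: "\<And>t. t < 8 \<Longrightarrow> \<not> bad D t h i j"
    and no_clique: "\<not> (\<exists>Z. finite Z \<and> card Z = m \<and> (\<forall>z\<in>Z. strict_sorted z \<and> length z \<le> N) \<and>
       (\<forall>x\<in>Z. \<forall>y\<in>Z. x \<noteq> y \<longrightarrow> D x y))"
  shows "\<exists>v A B. config N v A B \<and>
    (\<forall>x\<in>config_points v A B. \<forall>y\<in>config_points v A B. x \<noteq> y \<longrightarrow> \<not> D x y)"
proof -
  define a b where "a = i - h" "b = j - i"
  define blk where "blk t len = [j + t * j..<j + t * j + len]" for t len
  define v where "v = [0..<h]"
  define A where "A n = blk (2 * n) a" for n
  define B where "B n k = blk (2 * prod_encode (n, k) + 1) b" for n k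
  have blk: "below (blk t l) (blk t' l')" if "t < t'" "l \<le> j" for t t' l l'
  proof -
    have "t * j + j \<le> t' * j"
      using that(1) by (metis Suc_leI add.commute mult_Suc mult_le_mono1)
    then show ?thesis
      using that by (auto simp: below_def blk_def)
  qed
  have len: "length v = h" "length (A n) = a" "length (B n k) = b" "h + a = i" "i + b = j"
    "a \<le> j" "b \<le> j" "a + b = j - h" "a > 0" "b > 0" for n k
    using hij by (auto simp: v_def A_def B_def blk_def a_b_def)
  have nA: "2 * n < 2 * prod_encode (n, k) + 1" for n k
    using le_prod_encode_1[of n k] by simp
  have AA: "below (A n) (A n')" if "n < n'" for n n'
    unfolding A_def using that len by (intro blk) auto
  have AB: "below (A n) (B n' k)" if "2 * n < 2 * prod_encode (n', k) + 1" for n n' k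
    unfolding A_def B_def using that len by (intro blk) auto
  have BA: "below (B n k) (A n')" if "2 * prod_encode (n, k) + 1 < 2 * n'" for n n' k
    unfolding A_def B_def using that len by (intro blk) auto
  have BB: "below (B n k) (B n' k')" if "prod_encode (n, k) < prod_encode (n', k')" for n n' k k'
    unfolding B_def using that len by (intro blk) auto
  have AB': "below (A n) (B n k)" for n k
    by (rule AB[OF nA])
  have srt: "strict_sorted v" "strict_sorted (A n)" "strict_sorted (B n k)" for n k
    by (auto simp: v_def A_def B_def blk_def)
  have vA: "below v (A n)" "below v (B n k)" for n k
    using hij by (auto simp: v_def A_def B_def blk_def below_def)
  note srt = srt vA AB' strict_sorted_append_iff
  have sorted: "strict_sorted (v @ A n @ B n k)" for n k
    by (simp add: srt)
  have "config N v A B"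
    unfolding config_def
  proof (intro conjI allI strict_monoI)
    show "length (v @ A n @ B n k) \<le> N" "A n \<noteq> []" "B n k \<noteq> []" for n k
      using len(1) len(2)[of n] len(3)[of n k] len(4,5,9,10) hij by auto
    then show "hd (A n) < hd (A n')" if "n < n'" for n n'
      using AA[OF that] hd_in_set unfolding below_def by blast
    show "hd (B n k) < hd (B n k')" if "k < k'" for n k k'
      using BB[OF prod_encode_strict_mono[OF that, of n]] \<open>\<And>n k. B n k \<noteq> []\<close> hd_in_set
      unfolding below_def by blast
  qed (use sorted in auto)
  have sib: "\<not> nesting D p (q - p) (q - p) 0 0" if "p < q" "q \<le> N" for p q
  proof
    assume "nesting D p (q - p) (q - p) 0 0"
    then show False
      using sibling_clique[OF can symD, of p "q - p" m] that no_clique by fastforce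
  qed
  have types: "\<not> nesting D h 0 a 0 0" "\<not> nesting D h 0 (a + b) 0 0" "\<not> nesting D i 0 b 0 0"
    "\<not> nesting D h a (a + b) 0 0" "\<not> nesting D h (a + b) a 0 0" "\<not> nesting D h a a b b"
    "\<not> crossing D h 0 a a b" "\<not> crossing D h a a b b"
    using good[of 0] good[of 1] good[of 2] good[of 3] good[of 4] good[of 5] good[of 6] good[of 7]
    unfolding bad_def len(8) by (simp_all add: a_b_def)
  have sibs: "\<not> nesting D h a a 0 0" "\<not> nesting D h (a + b) (a + b) 0 0" "\<not> nesting D i b b 0 0"
    using sib[of h i] sib[of h j] sib[of i j] hij unfolding len(8) by (simp_all add: a_b_def)
  note N_it = nesting_iff[OF can] and C_it = crossing_iff[OF can]
  have r1: "\<not> D v (v @ A n)" for n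
    using N_it[of v "[]" "A n" "[]" "[]"] sorted[of n 0] types(1) len hij
    by (simp add: srt)
  have r2: "\<not> D v (v @ A n @ B n k)" for n k
    using N_it[of v "[]" "A n @ B n k" "[]" "[]"] sorted[of n k] types(2) len hij
    by simp
  have r3: "\<not> D (v @ A n) (v @ A n @ B n k)" for n k
    using N_it[of "v @ A n" "[]" "B n k" "[]" "[]"] sorted[of n k] types(3) len hij
    by simp
  have r4: "\<not> D (v @ A n) (v @ A n')" if "n < n'" for n n'
  proof -
    have "strict_sorted (v @ A n @ A n')"
      using AA[OF that] by (simp add: srt)
    then show ?thesis
      using N_it[of v "A n" "A n'" "[]" "[]"] sibs(1) len hij by simp
  qed
  have r5: "\<not> D (v @ A n @ B n k) (v @ A n @ B n k')" if "k < k'" for n k k'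
  proof -
    have "strict_sorted (v @ A n @ B n k @ B n k')"
      using BB[OF prod_encode_strict_mono[OF that, of n]] by (simp add: srt)
    then show ?thesis
      using N_it[of "v @ A n" "B n k" "B n k'" "[]" "[]"] sibs(3) len hij by simp
  qed
  have r6: "\<not> D (v @ A n) (v @ A n' @ B n' k)" if "n < n'" for n n' k
  proof -
    have "2 * n < 2 * prod_encode (n', k) + 1"
      using nA[of n' k] that by simp
    then have "strict_sorted (v @ A n @ A n' @ B n' k)"
      using AA[OF that] AB[of n n' k] by (simp add: srt)
    then show ?thesis
      using N_it[of v "A n" "A n' @ B n' k" "[]" "[]"] types(4) len hij by simp
  qed
  have r7: "\<not> D (v @ A n @ B n k) (v @ A n')" if "n < n'" for n n' k
  proof (cases "2 * prod_encode (n, k) + 1 < 2 * n'")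
    case True
    then have "strict_sorted (v @ A n @ B n k @ A n')"
      using AA[OF that] BA[of n k n'] by (simp add: srt)
    then show ?thesis
      using N_it[of v "A n @ B n k" "A n'" "[]" "[]"] types(5) len hij by simp
  next
    case False
    then have "2 * n' < 2 * prod_encode (n, k) + 1"
      by presburger
    then have "strict_sorted (v @ A n @ A n' @ B n k)"
      using AA[OF that] AB[of n' n k] by (simp add: srt)
    \<comment> \<open>The limit point is now the node with empty first block and tail
      \<open>A n'\<close>, so the crossing type speaks of the pair in reverse order.\<close>
    then have "\<not> D (v @ A n') (v @ A n @ B n k)"
      using C_it[of v "[]" "A n" "A n'" "B n k"] types(7) len hij by simp
    then show ?thesis
      using symD by blast
  qed
  have r8: "\<not> D (v @ A n @ B n k) (v @ A n' @ B n' k')" if n: "n < n'" for n n' k k'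
  proof -
    have pe: "prod_encode (n, k) \<noteq> prod_encode (n', k')"
      using n by simp
    have n2: "2 * n < 2 * prod_encode (n', k') + 1"
      using nA[of n' k'] that by simp
    have "2 * prod_encode (n, k) + 1 < 2 * n' \<or> 2 * n' < 2 * prod_encode (n, k) + 1"
      by presburger
    \<comment> \<open>Either the nodes occupy separate blocks, or \<open>A n\<close> and
      \<open>A n'\<close> precede both tails, whose order decides between crossing and
      nesting.\<close>
    with pe consider "2 * prod_encode (n, k) + 1 < 2 * n'"
      | "2 * n' < 2 * prod_encode (n, k) + 1" "prod_encode (n, k) < prod_encode (n', k')"
      | "2 * n' < 2 * prod_encode (n, k) + 1" "prod_encode (n', k') < prod_encode (n, k)"
      by (metis nat_neq_iff)
    then show ?thesis
    proof cases
      case 1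
      then have "2 * prod_encode (n, k) + 1 < 2 * prod_encode (n', k') + 1"
        using nA[of n' k'] by linarith
      then have "strict_sorted (v @ A n @ B n k @ A n' @ B n' k')"
        using BA[OF 1] AB[OF n2] BB[of n k n' k'] AA[OF n] by (simp add: srt)
      then show ?thesis
        using N_it[of v "A n @ B n k" "A n' @ B n' k'" "[]" "[]"] sibs(2) len hij by simp
    next
      case 2
      then have "strict_sorted (v @ A n @ A n' @ B n k @ B n' k')"
        using AB[OF 2(1)] AB[OF n2] BB[OF 2(2)] AA[OF n] by (simp add: srt)
      then show ?thesis
        using C_it[of v "A n" "A n'" "B n k" "B n' k'"] types(8) len hij by simp
    next
      case 3
      then have "strict_sorted (v @ A n @ A n' @ B n' k' @ B n k)"
        using AB[OF 3(1)] AB[OF n2] BB[OF 3(2)] AA[OF n] by (simp add: srt)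
      then show ?thesis
        using N_it[of v "A n" "A n'" "B n' k'" "B n k"] types(6) len hij by simp
    qed
  qed
  have XX: "\<not> D (v @ A n) (v @ A n')" if "n \<noteq> n'" for n n'
    using r4[of n n'] r4[of n' n] symD[of "v @ A n" "v @ A n'"] that by (meson linorder_neqE_nat)
  have XY: "\<not> D (v @ A n) (v @ A n' @ B n' k)" for n n' k
    using r3[of n k] r6[of n n' k] r7[of n' n k] symD[of "v @ A n" "v @ A n' @ B n' k"]
    by (metis linorder_neqE_nat)
  have YY: "\<not> D (v @ A n @ B n k) (v @ A n' @ B n' k')" if "(n, k) \<noteq> (n', k')" for n k n' k'
    using r5[of k k' n] r5[of k' k n] r8[of n n' k k'] r8[of n' n k' k]
      symD[of "v @ A n @ B n k" "v @ A n' @ B n' k'"] that by (metis linorder_neqE_nat)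
  have XX': "\<not> D (v @ A n) (v @ A n')" if "A n \<noteq> A n'" for n n'
    using XX[of n n'] that by fastforce
  have YY': "\<not> D (v @ A n @ B n k) (v @ A n' @ B n' k')" if "A n @ B n k \<noteq> A n' @ B n' k'" for n k n' k'
    using YY[of n k n' k'] that by fastforce
  have pts: "x = v \<or> (\<exists>n. x = v @ A n) \<or> (\<exists>n k. x = v @ A n @ B n k)" if "x \<in> config_points v A B" for x
    using that by (auto simp: config_points_def)
  have rs: "\<not> D (v @ A n) v" "\<not> D (v @ A n @ B n k) v" "\<not> D (v @ A n @ B n k) (v @ A n')" for n n' k
    using r1[of n] r2[of n k] XY[of n' n k] symD by blast+
  have "\<not> D x y" if xy: "x \<in> config_points v A B" "y \<in> config_points v A B" "x \<noteq> y" for x y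
    using pts[OF xy(1)] pts[OF xy(2)] xy(3)
    by (elim disjE exE) (simp_all add: r1 r2 rs XX' XY YY')
  with \<open>config N v A B\<close> show ?thesis
    by blast
qed

text \<open>Cliques and configurations found for the thinned colouring are carried back by
  \<open>map g\<close>: a strictly increasing \<open>g\<close> preserves lengths, sortedness,
  distinctness and the order of heads.\<close>

theorem clique_or_config:
  "\<exists>N. \<forall>C. (\<forall>x y. C x y \<longrightarrow> C y x) \<longrightarrow> (\<forall>x. \<not> C x x) \<longrightarrow>
     (\<exists>Z. finite Z \<and> card Z = m \<and> (\<forall>z\<in>Z. strict_sorted z \<and> length z \<le> N) \<and>
       (\<forall>x\<in>Z. \<forall>y\<in>Z. x \<noteq> y \<longrightarrow> C x y)) \<or>
     (\<exists>v A B. config N v A B \<and> (\<forall>x\<in>config_points v A B. \<forall>y\<in>config_points v A B. x \<noteq> y \<longrightarrow> \<not> C x y))"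
proof -
  obtain N where N: "\<forall>D. canonical (2 * N) D \<longrightarrow> (\<forall>x y. D x y \<longrightarrow> D y x) \<longrightarrow> (\<forall>x. \<not> D x x) \<longrightarrow>
     (\<exists>h i j. h < i \<and> i < j \<and> j \<le> N \<and> (\<forall>t<8. \<not> bad D t h i j)) \<or>
     (\<exists>Z. finite Z \<and> card Z = m \<and> (\<forall>z\<in>Z. strict_sorted z \<and> length z \<le> N) \<and>
       (\<forall>x\<in>Z. \<forall>y\<in>Z. x \<noteq> y \<longrightarrow> D x y))"
    using good_triple_or_clique[of m] ..
  show ?thesis
  proof (intro exI[of _ N] allI impI)
    fix C :: "nat list \<Rightarrow> nat list \<Rightarrow> bool"
    assume C: "\<forall>x y. C x y \<longrightarrow> C y x" "\<forall>x. \<not> C x x"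
    obtain g where g: "strict_mono g" and can: "canonical (2 * N) (\<lambda>xs ys. C (map g xs) (map g ys))"
      by (rule canonical_subtree[where C = C and K = "2 * N"])
    define D where "D xs ys = C (map g xs) (map g ys)" for xs ys
    have canD: "canonical (2 * N) D"
      using can unfolding D_def .
    have D: "D x y \<Longrightarrow> D y x" "\<not> D x x" for x y
      using C unfolding D_def by blast+
    have inj: "inj (map g)"
      using g by (intro inj_mapI strict_mono_imp_inj_on)
    have sorted: "strict_sorted (map g z)" if "strict_sorted z" for z
      using that unfolding sorted_wrt_map strict_mono_less[OF g] .
    show "(\<exists>Z. finite Z \<and> card Z = m \<and> (\<forall>z\<in>Z. strict_sorted z \<and> length z \<le> N) \<and>
       (\<forall>x\<in>Z. \<forall>y\<in>Z. x \<noteq> y \<longrightarrow> C x y)) \<or>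
     (\<exists>v A B. config N v A B \<and> (\<forall>x\<in>config_points v A B. \<forall>y\<in>config_points v A B. x \<noteq> y \<longrightarrow> \<not> C x y))"
    proof (cases "\<exists>Z. finite Z \<and> card Z = m \<and> (\<forall>z\<in>Z. strict_sorted z \<and> length z \<le> N) \<and>
       (\<forall>x\<in>Z. \<forall>y\<in>Z. x \<noteq> y \<longrightarrow> D x y)")
      case True
      then obtain Z where Z': "finite Z \<and> card Z = m \<and> (\<forall>z\<in>Z. strict_sorted z \<and> length z \<le> N) \<and>
        (\<forall>x\<in>Z. \<forall>y\<in>Z. x \<noteq> y \<longrightarrow> D x y)" ..
      then have Z: "finite Z" "card Z = m" "\<forall>z\<in>Z. strict_sorted z \<and> length z \<le> N"
        "\<forall>x\<in>Z. \<forall>y\<in>Z. x \<noteq> y \<longrightarrow> D x y"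
        by simp_all
      have "card (map g ` Z) = m"
        using Z(2) inj by (metis card_image inj_on_subset subset_UNIV)
      moreover have "\<forall>x\<in>map g ` Z. \<forall>y\<in>map g ` Z. x \<noteq> y \<longrightarrow> C x y"
      proof (intro ballI impI)
        fix x y assume "x \<in> map g ` Z" "y \<in> map g ` Z" "x \<noteq> y"
        then obtain x' y' where "x = map g x'" "y = map g y'" "x' \<in> Z" "y' \<in> Z" "x' \<noteq> y'"
          by (elim imageE) metis
        then show "C x y"
          using Z(4) unfolding D_def by simp
      qed
      moreover have "\<forall>z\<in>map g ` Z. strict_sorted z \<and> length z \<le> N"
      proof
        fix z assume "z \<in> map g ` Z"
        then obtain y where "z = map g y" "y \<in> Z"
          by (rule imageE)
        then show "strict_sorted z \<and> length z \<le> N"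
          using sorted[of y] Z(3) by (simp only: length_map)
      qed
      ultimately show ?thesis
        using Z(1) by (intro disjI1 exI[of _ "map g ` Z"]) simp
    next
      case False
      have "\<forall>x y. D x y \<longrightarrow> D y x" "\<forall>x. \<not> D x x"
        using D by blast+
      with N canD False have "\<exists>h i j. h < i \<and> i < j \<and> j \<le> N \<and> (\<forall>t<8. \<not> bad D t h i j)"
        by (metis (no_types, lifting))
      then obtain h i j where hij: "h < i" "i < j" "j \<le> N" "\<And>t. t < 8 \<Longrightarrow> \<not> bad D t h i j"
        by blast
      have "\<exists>v A B. config N v A B \<and>
        (\<forall>x\<in>config_points v A B. \<forall>y\<in>config_points v A B. x \<noteq> y \<longrightarrow> \<not> D x y)"
        by (rule red_config[OF canD D(1) hij False])
      then obtain v A B where cfg: "config N v A B" and red: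
        "\<forall>x\<in>config_points v A B. \<forall>y\<in>config_points v A B. x \<noteq> y \<longrightarrow> \<not> D x y"
        by (elim exE conjE)
      let ?A = "\<lambda>n. map g (A n)" and ?B = "\<lambda>n k. map g (B n k)"
      have "config N (map g v) ?A ?B"
        unfolding config_def
      proof (intro conjI allI)
        show "strict_sorted (map g v @ ?A n @ ?B n k)" for n k
        proof -
          have "strict_sorted (v @ A n @ B n k)"
            using cfg unfolding config_def by (elim conjE allE)
          from sorted[OF this] show ?thesis
            by (simp only: map_append)
        qed
        show "strict_mono (\<lambda>n. hd (?A n))" "strict_mono (\<lambda>k. hd (?B n k))" for n
        proof -
          have ne: "A n \<noteq> []" "B n k \<noteq> []" for n k
            using cfg by (auto simp: config_def)
          show "strict_mono (\<lambda>n. hd (?A n))" "strict_mono (\<lambda>k. hd (?B n k))"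
            using cfg unfolding config_def strict_mono_def hd_map[OF ne(1)] hd_map[OF ne(2)]
              strict_mono_less[OF g] by blast+
        qed
      qed (use cfg in \<open>simp_all add: config_def\<close>)
      moreover have "config_points (map g v) ?A ?B = map g ` config_points v A B"
        by (auto simp: config_points_def image_Un image_image case_prod_unfold)
      moreover have "\<forall>x\<in>map g ` config_points v A B. \<forall>y\<in>map g ` config_points v A B. x \<noteq> y \<longrightarrow> \<not> C x y"
      proof (intro ballI impI)
        fix x y assume "x \<in> map g ` config_points v A B" "y \<in> map g ` config_points v A B" "x \<noteq> y"
        then obtain x' y' where "x = map g x'" "y = map g y'" "x' \<in> config_points v A B"
          "y' \<in> config_points v A B" "x' \<noteq> y'"
          by (elim imageE) metis
        then show "\<not> C x y"
          using red unfolding D_def by simp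
      qed
      ultimately show ?thesis
        by (intro disjI2 exI[of _ "map g v"] exI[of _ ?A] exI[of _ ?B]) simp
    qed
  qed
qed

subsection \<open>Closed copies and ordinal arithmetic\<close>

lemma Field_pair: "Partial_order r \<Longrightarrow> a \<in> Field r \<Longrightarrow> (a, a) \<in> r"
  by (simp add: partial_order_on_def preorder_on_def refl_on_def)

lemma topspace_ord_topology: "topspace (ord_topology r) = Field r"
  by (auto simp: ord_topology_def underS_def aboveS_def Field_def)

lemma openin_ord_topology:
  assumes "a \<in> Field r"
  shows "openin (ord_topology r) (underS r a)" "openin (ord_topology r) (aboveS r a)"
  unfolding ord_topology_def using assms by (auto intro!: topology_generated_by_Basis)

lemma underS_irrefl: "a \<notin> underS r a"
  by (simp add: underS_def)

lemma underS_trans: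
  assumes "Partial_order r" "a \<in> underS r b" "(b, c) \<in> r"
  shows "a \<in> underS r c"
  using assms unfolding underS_def partial_order_on_def preorder_on_def
  by (auto dest: transD antisymD)

lemma trans_underS:
  assumes "Partial_order r" "(a, b) \<in> r" "b \<in> underS r c"
  shows "a \<in> underS r c"
  using assms unfolding underS_def partial_order_on_def preorder_on_def
  by (auto dest: transD antisymD)

lemma aboveS_iff: "a \<in> aboveS r b \<longleftrightarrow> b \<in> underS r a"
  by (auto simp: aboveS_def underS_def)

text \<open>A strictly increasing \<open>g\<close> is an isomorphism onto its image with continuous
  inverse, since preimages of rays under the inverse are traces of rays. Continuity of
  \<open>g\<close> is at stake only at limits, where \<open>g a\<close> has to be the supremum of
  the earlier values. Preimages of lower rays are initial segments, hence rays or everything because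
  \<open>s\<close> is a well-order; preimages of upper rays are shown open at each point, according
  to whether it is least, a successor or a limit.\<close>

lemma closed_copy_image:
  assumes r: "Partial_order r" and s: "Well_order s" and g: "g ` Field s \<subseteq> Field r"
    and mono: "\<And>a b. a \<in> underS s b \<Longrightarrow> g a \<in> underS r (g b)"
    and cont: "\<And>a. a \<in> Field s \<Longrightarrow> underS s a = {} \<or> (\<exists>p. underS s a = under s p) \<or>
      (\<forall>b\<in>underS r (g a). \<exists>a'\<in>underS s a. b \<in> underS r (g a'))"
  shows "closed_copy r (g ` Field s) s"
proof -
  have ps: "Partial_order s"
    using s by (simp add: well_order_on_def linear_order_on_def)
  have tot: "a \<in> underS s b \<or> b \<in> underS s a" if "a \<in> Field s" "b \<in> Field s" "a \<noteq> b" for a b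
    using s that by (auto simp: well_order_on_def linear_order_on_def total_on_def underS_def)
  have inj: "inj_on g (Field s)"
    by (rule inj_onI) (metis tot mono underS_irrefl)
  let ?X = "g ` Field s"
  define f where "f = inv_into (Field s) g"
  have fg: "f (g a) = a" if "a \<in> Field s" for a
    using inj that by (simp add: f_def)
  have under_iff: "g a \<in> underS r (g b) \<longleftrightarrow> a \<in> underS s b" if "a \<in> Field s" "b \<in> Field s" for a b
  proof
    assume ab: "g a \<in> underS r (g b)"
    then have "a \<noteq> b"
      using underS_irrefl by fastforce
    moreover have "b \<notin> underS s a"
    proof
      assume "b \<in> underS s a"
      then have "(g b, g a) \<in> r"
        using mono by (simp add: underS_def)
      then show False
        using underS_trans[OF r ab] underS_irrefl by fastforce
    qed
    ultimately show "a \<in> underS s b"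
      using tot[OF that] by blast
  qed (rule mono)
  have iff: "(g a, g b) \<in> r \<longleftrightarrow> (a, b) \<in> s" if "a \<in> Field s" "b \<in> Field s" for a b
  proof (cases "a = b")
    case True
    then show ?thesis
      using Field_pair[OF r] Field_pair[OF ps] that g by blast
  next
    case False
    then have "g a \<noteq> g b"
      using that inj by (auto dest: inj_onD)
    then show ?thesis
      using under_iff[OF that] False by (simp add: underS_def)
  qed
  have FX: "Field (Restr r ?X) = ?X"
    using Field_pair[OF r] g unfolding Field_def by blast
  have "iso (Restr r ?X) s f"
    unfolding iso_iff2 FX
  proof (intro conjI ballI)
    show "bij_betw f ?X (Field s)"
      using inj unfolding f_def by (simp add: bij_betw_inv_into inj_on_imp_bij_betw)
    fix x y assume "x \<in> ?X" "y \<in> ?X"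
    then show "(x, y) \<in> Restr r ?X \<longleftrightarrow> (f x, f y) \<in> s"
      using iff fg by auto
  qed
  moreover have "homeomorphic_maps (subtopology (ord_topology r) ?X) (ord_topology s) f g"
    unfolding homeomorphic_maps_def
  proof (intro conjI ballI)
    let ?T = "subtopology (ord_topology r) ?X"
    have tX: "topspace ?T = ?X"
      using g by (auto simp: topspace_ord_topology)
    show "continuous_map ?T (ord_topology s) f"
      unfolding ord_topology_def[of s]
    proof (rule continuous_on_generated_topo)
      fix U assume "U \<in> insert (Field s) (underS s ` Field s \<union> aboveS s ` Field s)"
      then consider "U = Field s" | a where "a \<in> Field s" "U = underS s a" | a where "a \<in> Field s" "U = aboveS s a"
        by blast
      then show "openin ?T (f -` U \<inter> topspace ?T)"
      proof cases
        case 1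
        then have "f -` U \<inter> topspace ?T = topspace ?T"
          using fg unfolding tX by auto
        then show ?thesis
          by (metis openin_topspace)
      next
        case 2
        have eq: "f -` U \<inter> topspace ?T = underS r (g a) \<inter> ?X"
          unfolding tX using 2 fg under_iff by auto
        have "g a \<in> Field r"
          using 2(1) g by blast
        then show ?thesis
          unfolding eq by (intro openin_subtopology_Int openin_ord_topology)
      next
        case 3
        have eq: "f -` U \<inter> topspace ?T = aboveS r (g a) \<inter> ?X"
          unfolding tX using 3 fg under_iff by (auto simp: aboveS_iff)
        have "g a \<in> Field r"
          using 3(1) g by blast
        then show ?thesis
          unfolding eq by (intro openin_subtopology_Int openin_ord_topology)
      qed
    next
      show "f ` topspace ?T \<subseteq> \<Union> (insert (Field s) (underS s ` Field s \<union> aboveS s ` Field s))"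
        unfolding tX using fg by auto
    qed
    have "continuous_map (ord_topology s) (ord_topology r) g"
      unfolding ord_topology_def[of r]
    proof (rule continuous_on_generated_topo)
      fix U assume "U \<in> insert (Field r) (underS r ` Field r \<union> aboveS r ` Field r)"
      then consider "U = Field r" | b where "b \<in> Field r" "U = underS r b" | b where "b \<in> Field r" "U = aboveS r b"
        by blast
      then show "openin (ord_topology s) (g -` U \<inter> topspace (ord_topology s))"
      proof cases
        case 1
        then have "g -` U \<inter> topspace (ord_topology s) = topspace (ord_topology s)"
          using g by (auto simp: topspace_ord_topology)
        then show ?thesis
          by (metis openin_topspace)
      next
        case 2
        define I where "I = g -` U \<inter> Field s"
        have down: "a' \<in> I" if "a \<in> I" "a' \<in> underS s a" for a a'
        proof -
          have "(g a', g a) \<in> r"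
            using mono[OF that(2)] by (simp add: underS_def)
          then have "g a' \<in> underS r b"
            using trans_underS[OF r, of "g a'" "g a" b] that(1) by (simp add: I_def 2(2))
          moreover have "a' \<in> Field s"
            using that(2) by (auto simp: underS_def Field_def)
          ultimately show ?thesis
            by (simp add: I_def 2(2))
        qed
        have "I = Field s \<or> (\<exists>a\<in>Field s. I = underS s a)"
        proof (cases "I = Field s")
          case False
          then obtain a0 where "a0 \<in> Field s - I"
            unfolding I_def by blast
          moreover have "wf (s - Id)"
            using s by (simp add: well_order_on_def)
          ultimately obtain a where a: "a \<in> Field s - I" "\<And>y. (y, a) \<in> s - Id \<Longrightarrow> y \<notin> Field s - I"
            using wfE_min[of "s - Id" a0 "Field s - I"] by metis
          have "I = underS s a"
          proof
            show "underS s a \<subseteq> I"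
              using a(2) by (auto simp: underS_def Field_def)
            show "I \<subseteq> underS s a"
              using a(1) down tot unfolding I_def by blast
          qed
          with a(1) show ?thesis
            by blast
        qed simp
        then have "openin (ord_topology s) I"
        proof (elim disjE bexE)
          assume "I = Field s"
          then show ?thesis
            by (metis openin_topspace topspace_ord_topology)
        qed (simp add: openin_ord_topology)
        then show ?thesis
          by (simp add: I_def topspace_ord_topology)
      next
        case 3
        define I where "I = g -` U \<inter> Field s"
        have up: "a' \<in> I" if "a \<in> I" "a \<in> underS s a'" for a a'
        proof -
          have "(g a, g a') \<in> r"
            using mono[OF that(2)] by (simp add: underS_def)
          then have "b \<in> underS r (g a')"
            using underS_trans[OF r, of b "g a" "g a'"] that(1) by (simp add: I_def 3(2) aboveS_iff)
          moreover have "a' \<in> Field s"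
            using that(2) by (auto simp: underS_def Field_def)
          ultimately show ?thesis
            by (simp add: I_def 3(2) aboveS_iff)
        qed
        have "\<exists>T. openin (ord_topology s) T \<and> a \<in> T \<and> T \<subseteq> I" if a: "a \<in> I" for a
        proof -
          have aF: "a \<in> Field s"
            using a by (simp add: I_def)
          consider "underS s a = {}" | p where "p \<in> Field s" "underS s a = under s p"
            | "\<forall>b\<in>underS r (g a). \<exists>a'\<in>underS s a. b \<in> underS r (g a')"
          proof -
            have "p \<in> Field s" if "underS s a = under s p" "underS s a \<noteq> {}" for p
              using that by (auto simp: under_def Field_def)
            then show ?thesis
              using cont[OF aF] that by meson
          qed
          then show ?thesis
          proof cases
            case 1
            then have "Field s \<subseteq> I"
              using tot aF a up by blast
            then show ?thesis
              using openin_topspace[of "ord_topology s"] aF unfolding topspace_ord_topology by blast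
          next
            case 2
            have "p \<in> underS s a"
              using 2 Field_pair[OF ps] by (simp add: under_def)
            moreover have "aboveS s p \<subseteq> I"
            proof
              fix x assume x: "x \<in> aboveS s p"
              then have "x \<notin> underS s a"
                using ps unfolding 2(2) under_def aboveS_def partial_order_on_def
                by (auto dest: antisymD)
              moreover have "x \<in> Field s"
                using x by (auto simp: aboveS_def Field_def)
              ultimately show "x \<in> I"
                using tot aF a up by metis
            qed
            ultimately show ?thesis
              using openin_ord_topology(2)[OF 2(1)] aboveS_iff by metis
          next
            case lim: 3
            have "b \<in> underS r (g a)"
              using a by (simp add: I_def 3(2) aboveS_iff)
            with lim obtain a' where a': "a' \<in> underS s a" "b \<in> underS r (g a')"
              by blast
            have F: "a' \<in> Field s"
              using a'(1) by (auto simp: underS_def Field_def)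
            then have "a' \<in> I"
              using a'(2) by (simp add: I_def 3(2) aboveS_iff)
            then have "aboveS s a' \<subseteq> I"
              using up aboveS_iff by fast
            moreover have "a \<in> aboveS s a'"
              using a'(1) by (simp add: aboveS_iff)
            ultimately show ?thesis
              using openin_ord_topology(2)[OF F] by blast
          qed
        qed
        then show ?thesis
          unfolding topspace_ord_topology I_def[symmetric] by (subst openin_subopen) blast
      qed
    next
      show "g ` topspace (ord_topology s) \<subseteq> \<Union> (insert (Field r) (underS r ` Field r \<union> aboveS r ` Field r))"
        using g by (auto simp: topspace_ord_topology)
    qed
    then show "continuous_map (ord_topology s) ?T g"
      by (auto simp: continuous_map_in_subtopology topspace_ord_topology)
    show "g (f x) = x" if "x \<in> topspace ?T" for x
      using that fg by (auto simp: tX)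
    show "f (g y) = y" if "y \<in> topspace (ord_topology s)" for y
      using that fg by (simp add: topspace_ord_topology)
  qed
  ultimately show ?thesis
    unfolding closed_copy_def using g homeomorphic_map_maps by blast
qed

section \<open>Sums, powers and the exponent as orders\<close>

lemma underS_natLeq [simp]: "underS natLeq n = {..<n}"
  by (auto simp: underS_def natLeq_def)

lemma in_natLeq: "(a, b) \<in> natLeq \<longleftrightarrow> a \<le> b"
  by (simp add: natLeq_def)

lemma Field_natLeq_UNIV [simp]: "Field natLeq = UNIV"
  by (rule Field_natLeq)

lemma partial_orderI:
  assumes "\<And>a b. (a, b) \<in> r \<Longrightarrow> (a, a) \<in> r \<and> (b, b) \<in> r"
    and "\<And>a b c. (a, b) \<in> r \<Longrightarrow> (b, c) \<in> r \<Longrightarrow> (a, c) \<in> r"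
    and "\<And>a b. (a, b) \<in> r \<Longrightarrow> (b, a) \<in> r \<Longrightarrow> a = b"
  shows "Partial_order r"
  unfolding partial_order_on_def preorder_on_def
proof (intro conjI)
  show "refl_on (Field r) r"
    using assms(1) by (auto simp: refl_on_def Field_def)
  show "trans r"
    using assms(2) by (rule transI)
  show "antisym r"
    using assms(3) by (rule antisymI)
qed (auto simp: Field_def)

lemma Field_ord_add: "Field (r +\<^sub>o s) = Inl ` Field r \<union> Inr ` Field s"
  unfolding ord_add_def Field_def by (force simp: image_iff)

lemma in_ord_add:
  "(Inl a, Inl a') \<in> r +\<^sub>o s \<longleftrightarrow> (a, a') \<in> r"
  "(Inr b, Inr b') \<in> r +\<^sub>o s \<longleftrightarrow> (b, b') \<in> s"
  "(Inl a, Inr b) \<in> r +\<^sub>o s \<longleftrightarrow> a \<in> Field r \<and> b \<in> Field s"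
  "(Inr b, Inl a) \<notin> r +\<^sub>o s"
  by (auto simp: ord_add_def)

lemma Partial_order_ord_add:
  assumes "Partial_order r" "Partial_order s"
  shows "Partial_order (r +\<^sub>o s)"
proof (rule partial_orderI)
  have F: "a \<in> Field r" "b \<in> Field r" if "(a, b) \<in> r" for a b
    using that by (auto simp: Field_def)
  have G: "a \<in> Field s" "b \<in> Field s" if "(a, b) \<in> s" for a b
    using that by (auto simp: Field_def)
  have tr: "trans r" "trans s" and as: "antisym r" "antisym s"
    using assms by (auto simp: partial_order_on_def preorder_on_def)
  show "(a, a) \<in> r +\<^sub>o s \<and> (b, b) \<in> r +\<^sub>o s" if "(a, b) \<in> r +\<^sub>o s" for a b
    using that by (cases a; cases b) (auto simp: in_ord_add intro: F G
        Field_pair[OF assms(1)] Field_pair[OF assms(2)])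
  show "(a, c) \<in> r +\<^sub>o s" if "(a, b) \<in> r +\<^sub>o s" "(b, c) \<in> r +\<^sub>o s" for a b c
    using that by (cases a; cases b; cases c) (auto simp: in_ord_add dest: F G transD[OF tr(1)] transD[OF tr(2)])
  show "a = b" if "(a, b) \<in> r +\<^sub>o s" "(b, a) \<in> r +\<^sub>o s" for a b
    using that by (cases a; cases b) (auto simp: in_ord_add dest: antisymD[OF as(1)] antisymD[OF as(2)])
qed

lemma Field_ord_exp: "Field (r ^\<^sub>o s) = fin_supp r s"
  by (auto simp: ord_exp_def Field_def)

lemma Partial_order_ord_exp:
  assumes r: "Partial_order r" and s: "Linear_order s"
  shows "Partial_order (r ^\<^sub>o s)"
proof -
  have ps: "Partial_order s"
    using s by (simp add: linear_order_on_def)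
  have tri: "m = m' \<or> m' \<in> aboveS s m \<or> m \<in> aboveS s m'" if "m \<in> Field s" "m' \<in> Field s" for m m'
    using s that by (auto simp: linear_order_on_def total_on_def aboveS_def)
  have tr: "x \<in> aboveS s m" if "x \<in> aboveS s m'" "m' \<in> aboveS s m" for x m m'
    using underS_trans[OF ps, of m m' x] that unfolding aboveS_iff underS_def by simp
  have tr': "f \<in> underS r h" if "f \<in> underS r g" "g \<in> underS r h" for f g h
    using underS_trans[OF r, of f g h] that unfolding underS_def by simp
  \<comment> \<open>The larger of the two deciding arguments decides between \<open>f\<close> and
    \<open>h\<close>.\<close>
  have less_trans: "\<exists>m\<in>Field s. f m \<in> underS r (h m) \<and> (\<forall>x\<in>aboveS s m. f x = h x)"
    if fgh: "m \<in> Field s" "f m \<in> underS r (g m)" "\<forall>x\<in>aboveS s m. f x = g x"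
      "m' \<in> Field s" "g m' \<in> underS r (h m')" "\<forall>x\<in>aboveS s m'. g x = h x" for f g h m m'
  proof -
    consider "m = m'" | "m' \<in> aboveS s m" | "m \<in> aboveS s m'"
      using tri fgh(1,4) by blast
    then show ?thesis
    proof cases
      case 1
      then show ?thesis
        using fgh tr' by (intro bexI[of _ m]) auto
    next
      case 2
      then show ?thesis
        using fgh(3-6) tr[OF _ 2] by (intro bexI[of _ m']) auto
    next
      case 3
      then show ?thesis
        using fgh(1-3,6) tr[OF _ 3] by (intro bexI[of _ m]) auto
    qed
  qed
  show ?thesis
  proof (rule partial_orderI)
    fix f g h
    show "(f, f) \<in> r ^\<^sub>o s \<and> (g, g) \<in> r ^\<^sub>o s" if "(f, g) \<in> r ^\<^sub>o s"
      using that by (auto simp: ord_exp_def)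
    show "(f, h) \<in> r ^\<^sub>o s" if fgh: "(f, g) \<in> r ^\<^sub>o s" "(g, h) \<in> r ^\<^sub>o s"
    proof -
      have F: "f \<in> fin_supp r s" "h \<in> fin_supp r s"
        using fgh by (auto simp: ord_exp_def)
      consider "f = g" | "g = h" | m m' where "m \<in> Field s" "f m \<in> underS r (g m)" "\<forall>x\<in>aboveS s m. f x = g x"
          "m' \<in> Field s" "g m' \<in> underS r (h m')" "\<forall>x\<in>aboveS s m'. g x = h x"
        using fgh by (auto simp: ord_exp_def)
      then show ?thesis
      proof cases
        case 3
        from less_trans[OF this] F show ?thesis
          by (simp add: ord_exp_def)
      qed (use fgh in auto)
    qed
    show "f = g" if fg: "(f, g) \<in> r ^\<^sub>o s" "(g, f) \<in> r ^\<^sub>o s"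
    proof (rule ccontr)
      assume "f \<noteq> g"
      then obtain m m' where "m \<in> Field s" "f m \<in> underS r (g m)" "\<forall>x\<in>aboveS s m. f x = g x"
          "m' \<in> Field s" "g m' \<in> underS r (f m')" "\<forall>x\<in>aboveS s m'. g x = f x"
        using fg by (auto simp: ord_exp_def)
      \<comment> \<open>With \<open>f\<close> also as the third function, transitivity puts a value
        of \<open>f\<close> strictly below itself.\<close>
      from less_trans[OF this] underS_irrefl show False
        by fastforce
    qed
  qed
qed

lemma underS_ord_exp:
  "f \<in> underS (r ^\<^sub>o s) g \<longleftrightarrow> f \<in> fin_supp r s \<and> g \<in> fin_supp r s \<and>
    (\<exists>m\<in>Field s. f m \<in> underS r (g m) \<and> (\<forall>x\<in>aboveS s m. f x = g x))"
  unfolding underS_def[of "r ^\<^sub>o s"] using underS_irrefl by (fastforce simp: ord_exp_def)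

lemma Field_mult_natLeq: "Field (natLeq *\<^sub>o natLeq_on k) = UNIV \<times> {..<k}"
  by (auto simp: ord_mult_def Field_def natLeq_def underS_def)

lemma in_mult_natLeq: "((a, b), (a', b')) \<in> natLeq *\<^sub>o natLeq_on k \<longleftrightarrow>
    b < k \<and> b' < k \<and> (b < b' \<or> b = b' \<and> a \<le> a')"
  by (auto simp: ord_mult_def Field_natLeq_on in_natLeq underS_def)

lemma Linear_order_mult_natLeq: "Linear_order (natLeq *\<^sub>o natLeq_on k)"
  unfolding linear_order_on_def
proof
  show "Partial_order (natLeq *\<^sub>o natLeq_on k)"
    by (rule partial_orderI) (auto simp: in_mult_natLeq)
  show "total_on (Field (natLeq *\<^sub>o natLeq_on k)) (natLeq *\<^sub>o natLeq_on k)"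
    by (auto simp: total_on_def in_mult_natLeq Field_mult_natLeq)
qed

section \<open>The two ordinals of the theorem\<close>

definition omega_power_plus_one :: "nat \<Rightarrow> ((nat \<times> nat \<Rightarrow> nat) + nat) rel" where
  "omega_power_plus_one k = natLeq ^\<^sub>o (natLeq *\<^sub>o natLeq_on k) +\<^sub>o natLeq_on 1"

definition omega_squared_plus_one :: "((nat \<Rightarrow> nat) + nat) rel" where
  "omega_squared_plus_one = natLeq ^\<^sub>o natLeq_on 2 +\<^sub>o natLeq_on 1"

lemma Partial_order_natLeq: "Partial_order natLeq"
  using natLeq_Linear_order by (simp add: linear_order_on_def)

lemma Linear_order_natLeq_on: "Linear_order (natLeq_on n)"
  using natLeq_on_Well_order[of n] by (simp add: well_order_on_def)

lemma Partial_order_natLeq_on: "Partial_order (natLeq_on n)"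
  using Linear_order_natLeq_on[of n] unfolding linear_order_on_def by blast

lemma Partial_order_omega_power_plus_one: "Partial_order (omega_power_plus_one k)"
  unfolding omega_power_plus_one_def by (intro Partial_order_ord_add Partial_order_ord_exp Partial_order_natLeq
      Linear_order_mult_natLeq Partial_order_natLeq_on)

lemma fin_supp_natLeq_on_2: "f \<in> fin_supp natLeq (natLeq_on 2) \<longleftrightarrow> f \<in> extensional {..<2}"
proof -
  have "Field (natLeq_on 2) = {..<2}"
    unfolding Field_natLeq_on by auto
  then show ?thesis
    by (auto simp: fin_supp_def PiE_def)
qed

text \<open>Stands for the ordinal \<open>\<omega> \<cdot> n + m\<close>: argument 0 carries the
  finite part, argument 1 the coefficient of \<omega>.\<close>

definition pair_fun :: "nat \<Rightarrow> nat \<Rightarrow> nat \<Rightarrow> nat" where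
  "pair_fun n m = (\<lambda>i\<in>{..<2}. if i = 0 then m else n)"

lemma pair_fun: "pair_fun n m \<in> extensional {..<2}" "pair_fun n m 0 = m" "pair_fun n m (Suc 0) = n"
  by (auto simp: pair_fun_def)

lemma extensional_2_eqI: "f = g" if "f \<in> extensional {..<2}" "g \<in> extensional {..<2}" "f 0 = g 0" "f (Suc 0) = g (Suc 0)"
  for f g :: "nat \<Rightarrow> nat"
proof (rule extensionalityI[OF that(1,2)])
  fix x :: nat assume "x \<in> {..<2}"
  then have "x = 0 \<or> x = Suc 0"
    by auto
  then show "f x = g x"
    using that by blast
qed

lemma underS_omega_squared:
  "f \<in> underS (natLeq ^\<^sub>o natLeq_on 2) g \<longleftrightarrow> f \<in> extensional {..<2} \<and> g \<in> extensional {..<2} \<and>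
    (f (Suc 0) < g (Suc 0) \<or> f (Suc 0) = g (Suc 0) \<and> f 0 < g 0)"
proof -
  have "Field (natLeq_on 2) = {0, Suc 0}"
    unfolding Field_natLeq_on by auto
  moreover have "aboveS (natLeq_on 2) 0 = {Suc 0}" "aboveS (natLeq_on 2) (Suc 0) = {}"
    by (auto simp: aboveS_def)
  ultimately show ?thesis
    by (auto simp: underS_ord_exp fin_supp_natLeq_on_2)
qed

lemma underS_ord_add:
  "Inl a \<in> underS (r +\<^sub>o s) (Inl a') \<longleftrightarrow> a \<in> underS r a'"
  "Inr b \<in> underS (r +\<^sub>o s) (Inr b') \<longleftrightarrow> b \<in> underS s b'"
  "Inl a \<in> underS (r +\<^sub>o s) (Inr b) \<longleftrightarrow> a \<in> Field r \<and> b \<in> Field s"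
  "Inr b \<notin> underS (r +\<^sub>o s) (Inl a)"
  by (auto simp: underS_def in_ord_add)

lemma Field_natLeq_on_1: "Field (natLeq_on 1) = {0}"
  unfolding Field_natLeq_on by auto

lemma Field_omega_squared_plus_one: "Field omega_squared_plus_one = Inl ` extensional {..<2} \<union> {Inr 0}"
  unfolding omega_squared_plus_one_def Field_ord_add Field_natLeq_on_1 Field_ord_exp
  using fin_supp_natLeq_on_2 by auto

lemma underS_omega_squared_plus_one:
  "Inl f \<in> underS omega_squared_plus_one (Inl g) \<longleftrightarrow> f \<in> extensional {..<2} \<and> g \<in> extensional {..<2} \<and>
    (f (Suc 0) < g (Suc 0) \<or> f (Suc 0) = g (Suc 0) \<and> f 0 < g 0)"
  "Inl f \<in> underS omega_squared_plus_one (Inr n) \<longleftrightarrow> f \<in> extensional {..<2} \<and> n = 0"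
  "Inr n \<notin> underS omega_squared_plus_one x"
proof -
  show "Inl f \<in> underS omega_squared_plus_one (Inl g) \<longleftrightarrow> f \<in> extensional {..<2} \<and> g \<in> extensional {..<2} \<and>
    (f (Suc 0) < g (Suc 0) \<or> f (Suc 0) = g (Suc 0) \<and> f 0 < g 0)"
    unfolding omega_squared_plus_one_def underS_ord_add underS_omega_squared ..
  show "Inl f \<in> underS omega_squared_plus_one (Inr n) \<longleftrightarrow> f \<in> extensional {..<2} \<and> n = 0"
    unfolding omega_squared_plus_one_def underS_ord_add Field_natLeq_on_1 Field_ord_exp
      fin_supp_natLeq_on_2 by blast
  have "n \<notin> underS (natLeq_on 1) m" for m
    by (auto simp: underS_def)
  then show "Inr n \<notin> underS omega_squared_plus_one x"
    unfolding omega_squared_plus_one_def by (cases x) (simp_all only: underS_ord_add not_False_eq_True)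
qed

lemma Well_order_omega_squared_plus_one: "Well_order omega_squared_plus_one"
proof -
  let ?s = omega_squared_plus_one
  have ps: "Partial_order ?s"
    unfolding omega_squared_plus_one_def
    by (intro Partial_order_ord_add Partial_order_ord_exp Partial_order_natLeq
        Linear_order_natLeq_on Partial_order_natLeq_on)
  \<comment> \<open>The first component puts the top after all of \<open>\<omega>\<^sup>2\<close>;
    the others are the coefficients, leading one first.\<close>
  define key :: "(nat \<Rightarrow> nat) + nat \<Rightarrow> nat \<times> nat \<times> nat" where
    "key x = (case x of Inl f \<Rightarrow> (0, f (Suc 0), f 0) | Inr _ \<Rightarrow> (1, 0, 0))" for x
  have under: "x \<in> underS ?s y \<longleftrightarrow> x \<in> Field ?s \<and> y \<in> Field ?s \<and>
      (key x, key y) \<in> less_than <*lex*> less_than <*lex*> less_than" for x y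
    by (cases x; cases y) (auto simp: underS_omega_squared_plus_one Field_omega_squared_plus_one key_def)
  have "?s - Id \<subseteq> inv_image (less_than <*lex*> less_than <*lex*> less_than) key"
  proof (rule subrelI)
    fix x y assume "(x, y) \<in> ?s - Id"
    then have "x \<in> underS ?s y"
      by (simp add: underS_def)
    then show "(x, y) \<in> inv_image (less_than <*lex*> less_than <*lex*> less_than) key"
      unfolding under by simp
  qed
  moreover have "wf (inv_image (less_than <*lex*> less_than <*lex*> less_than) key)"
    by (intro wf_inv_image wf_lex_prod wf_less_than)
  ultimately have "wf (?s - Id)"
    by (rule wf_subset[rotated])
  moreover have "total_on (Field ?s) ?s"
  proof (rule total_onI)
    fix x y assume xy: "x \<in> Field ?s" "y \<in> Field ?s" "x \<noteq> y"
    have "key x \<noteq> key y"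
    proof
      assume key: "key x = key y"
      show False
      proof (cases x)
        case (Inl f)
        then obtain g where g: "y = Inl g"
          using key by (cases y) (auto simp: key_def)
        then have "f = g"
          using key xy Inl unfolding Field_omega_squared_plus_one key_def
          by (intro extensional_2_eqI) auto
        with Inl g xy show False
          by simp
      next
        case (Inr n)
        then show False
          using key xy unfolding Field_omega_squared_plus_one key_def by (cases y) auto
      qed
    qed
    then have "(key x, key y) \<in> less_than <*lex*> less_than <*lex*> less_than \<or>
        (key y, key x) \<in> less_than <*lex*> less_than <*lex*> less_than"
      by (cases "key x"; cases "key y") auto
    then have "x \<in> underS ?s y \<or> y \<in> underS ?s x"
      using xy unfolding under by blast
    then show "(x, y) \<in> ?s \<or> (y, x) \<in> ?s"
      by (auto simp: underS_def)
  qed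
  ultimately show ?thesis
    using ps by (simp add: well_order_on_def linear_order_on_def)
qed

subsection \<open>Embedding the tree of increasing sequences\<close>

text \<open>
  \<open>code N xs p\<close> is the coefficient of \<open>\<omega>\<^bsup>p\<^esup>\<close>. Prepending \<open>0\<close> gives the empty sequence a nonzero code. The last
  coefficient is increased by one so that extensions lie below, and the entries are doubled so that
  this cannot reach the code of the next sibling.
\<close>

definition code :: "nat \<Rightarrow> nat list \<Rightarrow> nat \<Rightarrow> nat" where
  "code N xs p = (if p \<le> N \<and> N - p \<le> length xs
     then 2 * ((0 # xs) ! (N - p)) + (if N - p = length xs then 1 else 0) else 0)"

definition emb :: "nat \<Rightarrow> nat \<Rightarrow> nat list \<Rightarrow> (nat \<times> nat \<Rightarrow> nat) + nat" where
  "emb k N xs = Inl (\<lambda>x\<in>UNIV \<times> {..<k}. if snd x = 0 then code N xs (fst x) else 0)"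

section \<open>The order of the codes\<close>

lemma fin_supp_mult_natLeq: "f \<in> fin_supp natLeq (natLeq *\<^sub>o natLeq_on k) \<longleftrightarrow>
    f \<in> extensional (UNIV \<times> {..<k}) \<and> finite {x \<in> UNIV \<times> {..<k}. f x \<noteq> 0}"
proof -
  have "{..<f x} \<noteq> {} \<longleftrightarrow> f x \<noteq> 0" for x
    by (auto simp: lessThan_empty_iff)
  then show ?thesis
    unfolding fin_supp_def Field_mult_natLeq underS_natLeq Field_natLeq_UNIV PiE_def by simp
qed

lemma aboveS_mult_natLeq: "(q, j) \<in> aboveS (natLeq *\<^sub>o natLeq_on k) (p, i) \<longleftrightarrow>
    i < k \<and> j < k \<and> (i < j \<or> i = j \<and> p < q)"
  by (auto simp: aboveS_def in_mult_natLeq)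

lemma underS_omega_power_plus_one: "Inl f \<in> underS (omega_power_plus_one k) (Inl g) \<longleftrightarrow>
    Inl f \<in> Field (omega_power_plus_one k) \<and> Inl g \<in> Field (omega_power_plus_one k) \<and>
    (\<exists>p i. i < k \<and> f (p, i) < g (p, i) \<and>
      (\<forall>q j. j < k \<longrightarrow> i < j \<or> i = j \<and> p < q \<longrightarrow> f (q, j) = g (q, j)))"
proof -
  have above: "(\<forall>x\<in>aboveS (natLeq *\<^sub>o natLeq_on k) (p, i). f x = g x) \<longleftrightarrow>
      (\<forall>q j. j < k \<longrightarrow> i < j \<or> i = j \<and> p < q \<longrightarrow> f (q, j) = g (q, j))" if "i < k" for p i
    unfolding Ball_def split_paired_All aboveS_mult_natLeq using that by blast
  have "(\<exists>m\<in>UNIV \<times> {..<k}. f m \<in> {..<g m} \<and> (\<forall>x\<in>aboveS (natLeq *\<^sub>o natLeq_on k) m. f x = g x)) \<longleftrightarrow>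
      (\<exists>p i. i < k \<and> f (p, i) < g (p, i) \<and>
        (\<forall>x\<in>aboveS (natLeq *\<^sub>o natLeq_on k) (p, i). f x = g x))"
    unfolding Bex_def split_paired_Ex by simp
  also have "\<dots> \<longleftrightarrow> (\<exists>p i. i < k \<and> f (p, i) < g (p, i) \<and>
      (\<forall>q j. j < k \<longrightarrow> i < j \<or> i = j \<and> p < q \<longrightarrow> f (q, j) = g (q, j)))"
    using above by (intro ex_cong1) blast
  finally show ?thesis
    unfolding omega_power_plus_one_def underS_ord_add underS_ord_exp underS_natLeq Field_mult_natLeq Field_ord_add Field_ord_exp
    by blast
qed

lemma underS_omega_power_plus_oneI:
  assumes "Inl f \<in> Field (omega_power_plus_one k)" "Inl g \<in> Field (omega_power_plus_one k)" "0 < k" "f (p, 0) < g (p, 0)"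
    "\<And>q j. j < k \<Longrightarrow> 0 < j \<or> p < q \<Longrightarrow> f (q, j) = g (q, j)"
  shows "Inl f \<in> underS (omega_power_plus_one k) (Inl g)"
  unfolding underS_omega_power_plus_one using assms by blast

lemma emb_in_Field: "emb k N xs \<in> Field (omega_power_plus_one k)"
proof -
  let ?f = "\<lambda>x\<in>UNIV \<times> {..<k}. if snd x = 0 then code N xs (fst x) else 0"
  have "{x \<in> UNIV \<times> {..<k}. ?f x \<noteq> 0} \<subseteq> {..N} \<times> {0}"
    by (auto simp: code_def split: if_splits)
  then have "finite {x \<in> UNIV \<times> {..<k}. ?f x \<noteq> 0}"
    by (rule finite_subset) simp
  then have "?f \<in> fin_supp natLeq (natLeq *\<^sub>o natLeq_on k)"
    unfolding fin_supp_mult_natLeq by (intro conjI restrict_extensional)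
  then show ?thesis
    unfolding emb_def omega_power_plus_one_def Field_ord_add Field_ord_exp by blast
qed

lemma emb_lessI:
  assumes "k \<ge> 1" "code N xs p < code N ys p" "\<And>q. q > p \<Longrightarrow> code N xs q = code N ys q"
  shows "emb k N xs \<in> underS (omega_power_plus_one k) (emb k N ys)"
  using emb_in_Field[of k N xs] emb_in_Field[of k N ys] assms
  unfolding emb_def by (intro underS_omega_power_plus_oneI[of _ _ _ p]) auto

text \<open>The strict Kleene-Brouwer order on finite sequences.\<close>

definition precedes :: "nat list \<Rightarrow> nat list \<Rightarrow> bool" where
  "precedes xs ys \<longleftrightarrow> (\<exists>p s. xs = ys @ p # s) \<or>
     (\<exists>u p q s t. xs = u @ p # s \<and> ys = u @ q # t \<and> p < q)"

lemma emb_less: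
  assumes k: "k \<ge> 1" and xs: "length xs \<le> N" and pr: "precedes xs ys"
  shows "emb k N xs \<in> underS (omega_power_plus_one k) (emb k N ys)"
  using pr unfolding precedes_def
proof (elim disjE exE conjE)
  fix p s assume *: "xs = ys @ p # s"
  show ?thesis
  proof (rule emb_lessI[OF k])
    \<comment> \<open>This exponent belongs to the last entry of \<open>0 # ys\<close>, where the
      code of \<open>ys\<close> has the extra 1 that its extension lacks.\<close>
    show "code N xs (N - length ys) < code N ys (N - length ys)"
      using xs by (auto simp: code_def * nth_append nth_Cons')
    show "code N xs q = code N ys q" if "q > N - length ys" for q
      using that xs by (auto simp: code_def * nth_append nth_Cons')
  qed
next
  fix u p q s t assume *: "xs = u @ p # s" "ys = u @ q # t" "p < q"
  show ?thesis
  proof (rule emb_lessI[OF k])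
    \<comment> \<open>In the worst case \<open>xs\<close> ends here and \<open>ys\<close> does not:
      \<open>2 * p + 1 < 2 * q\<close>.\<close>
    show "code N xs (N - Suc (length u)) < code N ys (N - Suc (length u))"
      using xs *(3) by (auto simp: code_def *(1,2) nth_append nth_Cons')
    show "code N xs x = code N ys x" if "x > N - Suc (length u)" for x
      using that xs by (auto simp: code_def *(1,2) nth_append nth_Cons')
  qed
qed

text \<open>
  The extension of \<open>t\<close> by \<open>x # s\<close> lowers the coefficient of \<open>\<omega>\<^bsup>N - length t\<^esup>\<close> by one and makes the next
  coefficient at least \<open>x\<close>, so such extensions converge to \<open>t\<close> as \<open>x\<close> grows.
\<close>

lemma emb_limit:
  assumes k: "k \<ge> 1" and b: "b \<in> underS (omega_power_plus_one k) (emb k N t)" and N: "length t < N"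
  obtains M where "\<And>s. s \<noteq> [] \<Longrightarrow> M \<le> hd s \<Longrightarrow> b \<in> underS (omega_power_plus_one k) (emb k N (t @ s))"
proof -
  let ?e = "\<lambda>xs. \<lambda>x\<in>UNIV \<times> {..<k}. if snd x = 0 then code N xs (fst x) else 0"
  have bF: "b \<in> Field (omega_power_plus_one k)"
    using b by (auto simp: underS_def Field_def)
  obtain f where f: "b = Inl f"
    using b unfolding emb_def omega_power_plus_one_def by (cases b) (auto simp: underS_ord_add)
  obtain p i where pi: "i < k" "f (p, i) < ?e t (p, i)"
    "\<And>q j. j < k \<Longrightarrow> i < j \<or> i = j \<and> p < q \<Longrightarrow> f (q, j) = ?e t (q, j)"
    using b unfolding f emb_def underS_omega_power_plus_one by blast
  have i: "i = 0"
    using pi(1,2) by (auto split: if_splits)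
  have fp: "f (p, 0) < code N t p"
    using pi(1,2) i by simp
  have fq: "f (q, 0) = code N t q" if "p < q" for q
    using pi(3)[of 0 q] k i that by simp
  have fj: "f (q, j) = 0" if "0 < j" "j < k" for q j
    using pi(3)[of j q] i that by simp
  have p: "p \<le> N" "N - p \<le> length t"
    using fp by (auto simp: code_def split: if_splits)
  have lessI: "b \<in> underS (omega_power_plus_one k) (emb k N xs)"
    if "f (r, 0) < code N xs r" "\<And>q. r < q \<Longrightarrow> f (q, 0) = code N xs q" for r xs
    using that k fj bF emb_in_Field[of k N xs] unfolding f emb_def
    by (intro underS_omega_power_plus_oneI[of _ _ _ r]) auto
  have cq: "code N (t @ s) q = code N t q" if "N - length t < q" "s \<noteq> []" for s q
    using that N by (auto simp: code_def nth_append nth_Cons')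
  show thesis
  \<comment> \<open>If \<open>b\<close> still falls short at \<open>p\<close> after the extension,
    any nonempty \<open>s\<close> will do. Otherwise \<open>p\<close> belongs to the last entry of
    \<open>0 # t\<close>, \<open>b\<close> agrees with the lowered coefficient there, and the
    coefficient at \<open>p - 1\<close> decides; \<open>length t < N\<close> ensures that this
    exponent exists.\<close>
  proof (rule that[of "Suc (f (p - 1, 0))"])
    fix s :: "nat list" assume s: "s \<noteq> []" "Suc (f (p - 1, 0)) \<le> hd s"
    show "b \<in> underS (omega_power_plus_one k) (emb k N (t @ s))"
    proof (cases "N - p = length t \<and> f (p, 0) = code N (t @ s) p")
      case False
      have "f (p, 0) < code N (t @ s) p"
      proof (cases "N - p = length t")
        case True
        then have "code N t p = Suc (code N (t @ s) p)"
          using p s(1) by (auto simp: code_def nth_append nth_Cons')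
        then show ?thesis
          using fp False True by simp
      next
        case F: False
        then have "N - length t < p"
          using p N by linarith
        then show ?thesis
          using fp cq[of p s] s(1) by simp
      qed
      moreover have "f (q, 0) = code N (t @ s) q" if "p < q" for q
        using fq[OF that] cq[of q s] s(1) p that by simp
      ultimately show ?thesis
        by (rule lessI)
    next
      case True
      have "p \<ge> 1"
        using True N by linarith
      have "N - (p - 1) = Suc (length t)"
        using True N p by linarith
      then have "2 * hd s \<le> code N (t @ s) (p - 1)"
        using s(1) p by (cases s) (auto simp: code_def nth_append)
      then have "f (p - 1, 0) < code N (t @ s) (p - 1)"
        using s(2) by linarith
      moreover have "f (q, 0) = code N (t @ s) q" if "p - 1 < q" for q
      proof (cases "q = p")
        case False
        then have "p < q"
          using that by linarith
        then show ?thesis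
          using fq cq[of q s] s(1) p by simp
      qed (use True in simp)
      ultimately show ?thesis
        by (rule lessI)
    qed
  qed
qed

text \<open>
  The point \<open>\<omega> \<cdot> (n + 1)\<close> is the supremum of the points \<open>\<omega> \<cdot> n + m\<close>, so for \<open>m > 0\<close> the latter are placed below
  the limit point with index \<open>n + 1\<close>.
\<close>

definition config_point :: "nat list \<Rightarrow> (nat \<Rightarrow> nat list) \<Rightarrow> (nat \<Rightarrow> nat \<Rightarrow> nat list) \<Rightarrow> (nat \<Rightarrow> nat) + nat \<Rightarrow> nat list" where
  "config_point v A B x = (case x of
     Inl f \<Rightarrow> (case f 0 of 0 \<Rightarrow> v @ A (f (Suc 0)) | Suc m \<Rightarrow> v @ A (Suc (f (Suc 0))) @ B (Suc (f (Suc 0))) m)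
   | Inr _ \<Rightarrow> v)"

section \<open>The configuration as a closed copy\<close>

lemma config_point_in: "config_point v A B x \<in> config_points v A B"
  by (auto simp: config_point_def config_points_def split: sum.split nat.split)

lemma config_point_simps:
  "config_point v A B (Inr n) = v"
  "f 0 = 0 \<Longrightarrow> config_point v A B (Inl f) = v @ A (f (Suc 0))"
  "f 0 = Suc m \<Longrightarrow> config_point v A B (Inl f) = v @ A (Suc (f (Suc 0))) @ B (Suc (f (Suc 0))) m"
  by (simp_all add: config_point_def)

lemma precedes_prefix: "precedes (u @ xs) (u @ ys)" if "precedes xs ys"
  using that unfolding precedes_def by (metis append.assoc)

lemma precedes_extension: "precedes (u @ xs) u" if "xs \<noteq> []"
  using that unfolding precedes_def by (metis neq_Nil_conv)

lemma precedes_hd: "precedes xs ys" if "xs \<noteq> []" "ys \<noteq> []" "hd xs < hd ys"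
  using that unfolding precedes_def by (metis append_Nil list.collapse)

lemma config_point_mono:
  assumes cfg: "config N v A B" and xy: "x \<in> underS omega_squared_plus_one y"
  shows "precedes (config_point v A B x) (config_point v A B y)"
proof -
  have ne: "A n \<noteq> []" "B n m \<noteq> []" for n m
    using cfg by (auto simp: config_def)
  have A: "hd (A n) < hd (A n')" if "n < n'" for n n'
    using cfg that by (auto simp: config_def strict_mono_def)
  have B: "hd (B n m) < hd (B n m')" if "m < m'" for n m m'
    using cfg that by (auto simp: config_def strict_mono_def)
  have AA: "precedes (v @ A n @ s) (v @ A n' @ s')" if "n < n'" for n n' s s'
    using A[OF that] ne by (intro precedes_prefix precedes_hd) auto
  have BB: "precedes (v @ A n @ B n m) (v @ A n @ B n m')" if "m < m'" for n m m'
    using B[OF that] ne by (intro precedes_prefix precedes_hd) auto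
  have AB: "precedes (v @ A n @ B n m) (v @ A n)" for n m
    using precedes_extension[of "B n m" "v @ A n"] ne by simp
  obtain f where x: "x = Inl f"
    using xy underS_omega_squared_plus_one(3) by (cases x) auto
  show ?thesis
  proof (cases y)
    case (Inr n)
    then show ?thesis
      using ne by (cases "f 0") (auto simp: x config_point_simps intro!: precedes_extension)
  next
    case (Inl g)
    have "f (Suc 0) < g (Suc 0) \<or> f (Suc 0) = g (Suc 0) \<and> f 0 < g 0"
      using xy unfolding x Inl underS_omega_squared_plus_one by blast
    then show ?thesis
    proof (elim disjE conjE)
      assume less: "f (Suc 0) < g (Suc 0)"
      show ?thesis
      proof (cases "f 0")
        case 0
        then show ?thesis
          using AA[OF less, of "[]"] AA[of "f (Suc 0)" "Suc (g (Suc 0))" "[]"] AA[OF less, of "[]" "[]"] less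
          by (cases "g 0") (simp_all add: x Inl config_point_simps)
      next
        case (Suc m)
        show ?thesis
        proof (cases "g 0")
          case 0
          \<comment> \<open>If the two indices of \<open>A\<close> agree, the smaller point is sent
            to an extension of the image of the larger one.\<close>
          then show ?thesis
            using AA[of "Suc (f (Suc 0))" "g (Suc 0)" _ "[]"] AB less Suc
            by (cases "Suc (f (Suc 0)) = g (Suc 0)") (auto simp: x Inl config_point_simps)
        next
          case (Suc m')
          then show ?thesis
            using AA[of "Suc (f (Suc 0))" "Suc (g (Suc 0))"] less \<open>f 0 = Suc m\<close>
            by (simp add: x Inl config_point_simps)
        qed
      qed
    next
      assume eq: "f (Suc 0) = g (Suc 0)" "f 0 < g 0"
      then obtain m' where m': "g 0 = Suc m'"
        by (cases "g 0") auto
      show ?thesis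
      proof (cases "f 0")
        case 0
        then show ?thesis
          using AA[of "f (Suc 0)" "Suc (f (Suc 0))" "[]"] eq(1) m'
          by (simp add: x Inl config_point_simps)
      next
        case (Suc m)
        then show ?thesis
          using BB[of m m'] eq m' by (simp add: x Inl config_point_simps)
      qed
    qed
  qed
qed

text \<open>The limits are the top and the points \<open>\<omega> \<cdot> (n + 1)\<close>. There
  \<open>emb_limit\<close> applies to \<open>v\<close> and to \<open>v @ A (Suc n)\<close>, because
  the heads of the approaching tails increase strictly and so exceed every bound.\<close>

lemma config_closed_copy:
  assumes k: "k \<ge> 1" and cfg: "config N v A B"
  shows "closed_copy (omega_power_plus_one k) ((\<lambda>x. emb k N (config_point v A B x)) ` Field omega_squared_plus_one)
    omega_squared_plus_one"
proof (rule closed_copy_image[OF Partial_order_omega_power_plus_one Well_order_omega_squared_plus_one])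
  let ?s = omega_squared_plus_one
  have ne: "A n \<noteq> []" "B n m \<noteq> []" and len: "length (v @ A n @ B n m) \<le> N" for n m
    using cfg by (auto simp: config_def)
  \<comment> \<open>Nodes with proper extensions in the configuration are shorter than
    \<open>N\<close>, as \<open>emb_limit\<close> requires.\<close>
  have lenv: "length v < N" "length (v @ A n) < N" for n
    using len[of n 0] ne(1)[of n] ne(2)[of n 0] by (auto simp: neq_Nil_conv)
  have len_point: "length (config_point v A B x) \<le> N" for x
    using len lenv(1) lenv(2)[THEN less_imp_le]
    by (auto simp: config_point_def split: sum.split nat.split intro: less_imp_le)
  show "(\<lambda>x. emb k N (config_point v A B x)) ` Field ?s \<subseteq> Field (omega_power_plus_one k)"
    using emb_in_Field by blast
  show "emb k N (config_point v A B x) \<in> underS (omega_power_plus_one k) (emb k N (config_point v A B y))"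
    if "x \<in> underS ?s y" for x y
    by (rule emb_less[OF k len_point config_point_mono[OF cfg that]])
  fix x assume x: "x \<in> Field ?s"
  show "underS ?s x = {} \<or> (\<exists>p. underS ?s x = under ?s p) \<or>
      (\<forall>b\<in>underS (omega_power_plus_one k) (emb k N (config_point v A B x)).
        \<exists>x'\<in>underS ?s x. b \<in> underS (omega_power_plus_one k) (emb k N (config_point v A B x')))"
  proof (cases x)
    case (Inr n)
    have "\<exists>x'\<in>underS ?s x. b \<in> underS (omega_power_plus_one k) (emb k N (config_point v A B x'))"
      if b: "b \<in> underS (omega_power_plus_one k) (emb k N (config_point v A B x))" for b
    proof -
      obtain M where M: "\<And>s. s \<noteq> [] \<Longrightarrow> M \<le> hd s \<Longrightarrow> b \<in> underS (omega_power_plus_one k) (emb k N (v @ s))"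
        using emb_limit[OF k _ lenv(1), of b] b unfolding Inr config_point_simps by metis
      have "M \<le> hd (A M)"
        using cfg strict_mono_imp_increasing[of "\<lambda>n. hd (A n)"] by (simp add: config_def)
      then have "b \<in> underS (omega_power_plus_one k) (emb k N (v @ A M))"
        using M ne by blast
      moreover have "Inl (pair_fun M 0) \<in> underS ?s x"
        using x by (auto simp: Inr underS_omega_squared_plus_one pair_fun Field_omega_squared_plus_one)
      moreover have "config_point v A B (Inl (pair_fun M 0)) = v @ A M"
        by (simp add: config_point_simps pair_fun)
      ultimately show ?thesis
        by metis
    qed
    then show ?thesis
      by blast
  next
    case (Inl f)
    have f: "f \<in> extensional {..<2}"
      using x by (auto simp: Inl Field_omega_squared_plus_one)
    consider "f 0 = 0" "f (Suc 0) = 0" | n where "f 0 = 0" "f (Suc 0) = Suc n" | m where "f 0 = Suc m"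
      by (metis not0_implies_Suc)
    then show ?thesis
    proof cases
      case 1
      have "y \<notin> underS ?s x" for y
        using 1 by (cases y) (simp_all add: Inl underS_omega_squared_plus_one)
      then show ?thesis
        by blast
    next
      case 2
      have "\<exists>x'\<in>underS ?s x. b \<in> underS (omega_power_plus_one k) (emb k N (config_point v A B x'))"
        if b: "b \<in> underS (omega_power_plus_one k) (emb k N (config_point v A B x))" for b
      proof -
        have px: "config_point v A B x = v @ A (Suc n)"
          using 2 by (simp add: Inl config_point_simps)
        obtain M where M: "\<And>s. s \<noteq> [] \<Longrightarrow> M \<le> hd s \<Longrightarrow> b \<in> underS (omega_power_plus_one k) (emb k N ((v @ A (Suc n)) @ s))"
          using emb_limit[OF k _ lenv(2), of b] b unfolding px by metis
        have "M \<le> hd (B (Suc n) M)"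
          using cfg strict_mono_imp_increasing[of "\<lambda>m. hd (B (Suc n) m)"] by (simp add: config_def)
        then have "b \<in> underS (omega_power_plus_one k) (emb k N (v @ A (Suc n) @ B (Suc n) M))"
          using M[of "B (Suc n) M"] ne by simp
        moreover have "Inl (pair_fun n (Suc M)) \<in> underS ?s x"
          using 2 f by (simp add: Inl underS_omega_squared_plus_one pair_fun)
        moreover have "config_point v A B (Inl (pair_fun n (Suc M))) = v @ A (Suc n) @ B (Suc n) M"
          by (simp add: config_point_simps pair_fun)
        ultimately show ?thesis
          by metis
      qed
      then show ?thesis
        by blast
    next
      case 3
      let ?p = "Inl (pair_fun (f (Suc 0)) m)"
      have pF: "?p \<in> Field ?s"
        by (auto simp: Field_omega_squared_plus_one pair_fun)
      have ps: "Partial_order ?s"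
        using Well_order_omega_squared_plus_one by (simp add: well_order_on_def linear_order_on_def)
      have un: "y \<in> under ?s ?p \<longleftrightarrow> y = ?p \<or> y \<in> underS ?s ?p" for y
        using Field_pair[OF ps pF] by (auto simp: under_def underS_def)
      have "y \<in> underS ?s x \<longleftrightarrow> y \<in> under ?s ?p" for y
      proof (cases y)
        case y: (Inl g)
        have "g = pair_fun (f (Suc 0)) m \<longleftrightarrow> g \<in> extensional {..<2} \<and> g 0 = m \<and> g (Suc 0) = f (Suc 0)"
          using extensional_2_eqI[of g "pair_fun (f (Suc 0)) m"] pair_fun by metis
        then show ?thesis
          unfolding un y Inl using 3 f
          by (auto simp: underS_omega_squared_plus_one pair_fun less_Suc_eq)
      next
        case (Inr n)
        then show ?thesis
          unfolding un by (simp add: underS_omega_squared_plus_one)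
      qed
      then show ?thesis
        by blast
    qed
  qed
qed

section \<open>Pulling the colouring back to sequences\<close>

theorem corollary9p2:
  fixes k :: nat
  assumes "k \<ge> 1"
  shows "closed_arrow (natLeq ^\<^sub>o (natLeq *\<^sub>o natLeq_on k) +\<^sub>o natLeq_on 1)
           (natLeq ^\<^sub>o natLeq_on 2 +\<^sub>o natLeq_on 1) (k + 2)"
  unfolding omega_power_plus_one_def[symmetric] omega_squared_plus_one_def[symmetric] closed_arrow_def
proof
  fix c :: "((nat \<times> nat \<Rightarrow> nat) + nat) set \<Rightarrow> colour"
  obtain N where N: "\<forall>C. (\<forall>x y. C x y \<longrightarrow> C y x) \<longrightarrow> (\<forall>x. \<not> C x x) \<longrightarrow>
     (\<exists>Z. finite Z \<and> card Z = k + 2 \<and> (\<forall>z\<in>Z. strict_sorted z \<and> length z \<le> N) \<and>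
       (\<forall>x\<in>Z. \<forall>y\<in>Z. x \<noteq> y \<longrightarrow> C x y)) \<or>
     (\<exists>v A B. config N v A B \<and> (\<forall>x\<in>config_points v A B. \<forall>y\<in>config_points v A B. x \<noteq> y \<longrightarrow> \<not> C x y))"
    using clique_or_config[of "k + 2"] ..
  \<comment> \<open>Requiring distinct images makes \<open>C\<close> irreflexive, and it makes
    \<open>emb k N\<close> injective on every clique of \<open>C\<close>.\<close>
  define C where "C xs ys \<longleftrightarrow> emb k N xs \<noteq> emb k N ys \<and> c {emb k N xs, emb k N ys} = Blue" for xs ys
  have "\<forall>x y. C x y \<longrightarrow> C y x" "\<forall>x. \<not> C x x"
    unfolding C_def by (metis insert_commute, blast)
  with N have "(\<exists>Z. finite Z \<and> card Z = k + 2 \<and> (\<forall>z\<in>Z. strict_sorted z \<and> length z \<le> N) \<and>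
       (\<forall>x\<in>Z. \<forall>y\<in>Z. x \<noteq> y \<longrightarrow> C x y)) \<or>
     (\<exists>v A B. config N v A B \<and> (\<forall>x\<in>config_points v A B. \<forall>y\<in>config_points v A B. x \<noteq> y \<longrightarrow> \<not> C x y))"
    by presburger
  then show "(\<exists>X. closed_copy (omega_power_plus_one k) X omega_squared_plus_one \<and> (\<forall>e\<in>[X]\<^bsup>2\<^esup>. c e = Red)) \<or>
     (\<exists>Y\<in>[Field (omega_power_plus_one k)]\<^bsup>(k + 2)\<^esup>. \<forall>e\<in>[Y]\<^bsup>2\<^esup>. c e = Blue)"
  proof (elim disjE exE conjE)
    fix Z assume Z: "finite Z" "card Z = k + 2" "\<forall>x\<in>Z. \<forall>y\<in>Z. x \<noteq> y \<longrightarrow> C x y"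
    have "inj_on (emb k N) Z"
      using Z(3) by (auto simp: inj_on_def C_def)
    then have "emb k N ` Z \<in> [Field (omega_power_plus_one k)]\<^bsup>(k + 2)\<^esup>"
      using Z(1,2) emb_in_Field by (auto simp: nsets_def card_image)
    moreover have "c e = Blue" if "e \<in> [emb k N ` Z]\<^bsup>2\<^esup>" for e
      using that Z(3) by (auto elim!: nsets2_E simp: C_def)
    ultimately show ?thesis
      by blast
  next
    fix v A B assume cfg: "config N v A B"
      and red: "\<forall>x\<in>config_points v A B. \<forall>y\<in>config_points v A B. x \<noteq> y \<longrightarrow> \<not> C x y"
    let ?X = "(\<lambda>x. emb k N (config_point v A B x)) ` Field omega_squared_plus_one"
    have "c e = Red" if e: "e \<in> [?X]\<^bsup>2\<^esup>" for e
    proof -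
      obtain x y where xy: "e = {emb k N (config_point v A B x), emb k N (config_point v A B y)}"
        "emb k N (config_point v A B x) \<noteq> emb k N (config_point v A B y)"
        using e by (auto elim!: nsets2_E)
      then have "\<not> C (config_point v A B x) (config_point v A B y)"
        using red config_point_in[of v A B] by metis
      then show ?thesis
        using xy by (cases "c e") (auto simp: C_def)
    qed
    then show ?thesis
      using config_closed_copy[OF assms cfg] by blast
  qed
qed

end
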